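(* Let $x,y$ be positive integers with $x<y$ and $\gcd(x,y)=1$. Then the period $p(x,y)$ of a periodic orbit on the $120^\circ$-isosceles triangle $\triangle ABC$ with initial angle $\Theta=\arctan\left(\frac{y}{x}\sqrt{3}\right)$ is $$p(x,y)=\begin{cases} 4y+\frac{2x}{3} & \text{if } x\equiv 0 \bmod 3 \text{ and } x\equiv y \bmod 2,\\ 8y+\frac{4x}{3} & \text{if } x\equiv 0 \bmod 3 \text{ and } x\not\equiv y \bmod 2,\\ 4y+\frac{2x-2}{3} \text{ or } 8y+\frac{4x+2}{3} & \text{if } x\equiv 1 \bmod 3 \text{ and } x\equiv y \bmod 2,\\ 16y+\frac{8x-2}{3} \text{ or } 8y+\frac{4x+2}{3} & \text{if } x\equiv 1 \bmod 3 \text{ and } x\not\equiv y \bmod 2,\\ 4y+\frac{2x+2}{3} \text{ or } 8y+\frac{4x-2}{3} & \text{if } x\equiv 2 \bmod 3 \text{ and } x\equiv y \bmod 2,\\ 16y+\frac{8x+2}{3} \text{ or } 8y+\frac{4x-2}{3} & \text{if } x\equiv 2 \bmod 3 \text{ and } x\not\equiv y \bmod 2. \end{cases}$$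
   Context: Billiards: a point particle moves with unit speed along straight lines in a polygon $G$, reflecting elastically at the edges (angle of incidence equals angle of reflection). Its path is its orbit. An orbit that reaches a vertex terminates and is singular; otherwise it is non-singular. A non-singular orbit is periodic if it begins and ends at the same point and the particle retraces its orbit when allowed to continue. A periodic orbit is primitive if it is traversed exactly once. The period of a periodic orbit is the number of times the particle strikes $\partial G$ while traversing a primitive sub-orbit. Triangle: $\triangle ABC$ is isosceles with $\angle B=120^\circ$, base $\overline{AC}$ horizontal with $A$ to the left of $C$, and apex $B$ above $\overline{AC}$. Orbits start at a point $P$ in the interior of the base $\overline{AC}$ and initially move into the triangle; the initial angle $\Theta$ is the angle between the ray from $P$ towards $C$ and the initial direction of motion. *)

theory Defs
  imports "HOL-Analysis.Analysis"
begin

text \<open>The Euclidean plane is the type \<^typ>\<open>complex\<close> with its real inner product; the horizontal and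
  vertical coordinates are \<^const>\<open>Re\<close> and \<^const>\<open>Im\<close>.\<close>

definition vec_angle :: "complex \<Rightarrow> complex \<Rightarrow> real" where
  "vec_angle u v = arccos (u \<bullet> v / (norm u * norm v))"

definition isosceles_120 :: "complex \<Rightarrow> complex \<Rightarrow> complex \<Rightarrow> bool" where
  "isosceles_120 A B C \<longleftrightarrow>
     dist A B = dist B C \<and> vec_angle (A - B) (C - B) = 2 * pi / 3 \<and>
     Im A = Im C \<and> Re A < Re C \<and> Im A < Im B"

text \<open>The elastic reflection of a velocity \<open>v\<close> at an edge with direction \<open>w\<close>: the component of \<open>v\<close>
  along \<open>w\<close> is kept and the component normal to \<open>w\<close> is negated.\<close>

definition elastic_reflection :: "complex \<Rightarrow> complex \<Rightarrow> complex" where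
  "elastic_reflection w v = (2 * (v \<bullet> w) / (w \<bullet> w)) *\<^sub>R w - v"

text \<open>A non-singular orbit never terminates, so it is a motion \<open>q\<close> defined for all times \<open>s \<ge> 0\<close>
  (the values of \<open>q\<close> at negative times are irrelevant). The parameter \<open>u\<close> is its initial velocity.
  The times \<open>t (Suc n)\<close> are those at which the particle strikes the boundary; since
  \<^const>\<open>open_segment\<close> excludes the endpoints, no vertex is ever reached. Just after time \<open>0\<close> the
  particle is in the interior of the triangle, so an orbit that starts on an edge moves into the
  triangle.\<close>

definition nonsingular_orbit ::
    "complex \<Rightarrow> complex \<Rightarrow> complex \<Rightarrow> complex \<Rightarrow> (real \<Rightarrow> complex) \<Rightarrow> bool" where
  "nonsingular_orbit A B C u q \<longleftrightarrow>
     q 0 \<in> convex hull {A, B, C} - {A, B, C} \<and>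
     (\<exists>(t :: nat \<Rightarrow> real) (v :: nat \<Rightarrow> complex).
        t 0 = 0 \<and> v 0 = u \<and> norm u = 1 \<and>
        (\<forall>n. t n < t (Suc n)) \<and> filterlim t at_top sequentially \<and>
        (\<forall>n. \<forall>s\<in>{t n..t (Suc n)}. q s = q (t n) + (s - t n) *\<^sub>R v n) \<and>
        (\<forall>n. \<forall>s\<in>{t n<..<t (Suc n)}. q s \<in> interior (convex hull {A, B, C})) \<and>
        (\<forall>n. \<exists>(a, b)\<in>{(A, B), (B, C), (C, A)}.
           q (t (Suc n)) \<in> open_segment a b \<and>
           v (Suc n) = elastic_reflection (b - a) (v n)))"

text \<open>The motion \<open>q\<close>, stopped at time \<open>T\<close>, has returned to its starting point and, when allowed to
  continue, retraces itself.\<close>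

definition retraces_after :: "(real \<Rightarrow> complex) \<Rightarrow> real \<Rightarrow> bool" where
  "retraces_after q T \<longleftrightarrow> 0 < T \<and> (\<forall>s\<ge>0. q (s + T) = q s)"

definition periodic_orbit :: "(real \<Rightarrow> complex) \<Rightarrow> bool" where
  "periodic_orbit q \<longleftrightarrow> (\<exists>T. retraces_after q T)"

definition primitive_duration :: "(real \<Rightarrow> complex) \<Rightarrow> real" where
  "primitive_duration q = (LEAST T. retraces_after q T)"

text \<open>One traversal corresponds to the half-open time interval from \<open>0\<close> (excluded) to the primitive
  duration (included), so for an orbit starting on the boundary the common start and end point is
  counted once.\<close>

definition orbit_period :: "complex \<Rightarrow> complex \<Rightarrow> complex \<Rightarrow> (real \<Rightarrow> complex) \<Rightarrow> nat" where
  "orbit_period A B C q =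
     card {s \<in> {0<..primitive_duration q}. q s \<in> frontier (convex hull {A, B, C})}"

end

theory Submission
  imports Defs
begin

text \<open>Reflecting the triangle in its sides again and again tiles the plane: the equilateral triangles of
the lattice \<open>\<int> + \<int>\<omega>\<close>, with \<open>\<omega>\<close> a primitive sixth root of unity, are each cut into three
\<open>120\<close>-degree triangles by the segments from the centre to the corners. The bases form the edges
of the lattice, the two equal sides form the segments from centres to lattice points. An orbit
unfolds to a straight line in this tiling, and each bounce becomes the crossing of an edge
(\<open>unfolding_isometry\<close>, \<open>strike_iff_edge\<close>). The isometries that unfold the orbit all lie in the
symmetry group of the lattice, but three tiles meet at a centre, an odd number. So the isometry that
carries a tile back to the triangle is determined only up to the symmetry of the triangle in its
axis (\<open>chamber_stabilizer\<close>).

The initial direction is that of a primitive lattice vector \<open>D = a + b\<omega>\<close>; it is proportional to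
\<open>x + y\<surd>3 \<i>\<close>, so \<open>2a + b = ex\<close> and \<open>b = ey\<close> with \<open>e = 1\<close> or \<open>e = 2\<close> according as \<open>x\<close> and \<open>y\<close> have
equal or different parity. After the translation by \<open>D\<close> the particle is therefore back at its
starting point or at the mirror image of that point, and in the second case the orbit closes up
after \<open>2D\<close>. The cases are told apart by the parity of the number \<open>E\<close> (\<open>side_hits\<close>) of crossings of equal
sides along \<open>D\<close>:
at such a crossing the real part of the cube of the velocity changes sign, at a crossing of a base
it does not (\<open>side_bounce_parity\<close>). No shorter closed orbit exists, since a velocity that is not
parallel to a mirror determines the linear part of the unfolding isometry, and \<open>D\<close> is primitive
(\<open>retraces_after_integer\<close>).

The line crosses \<open>2b\<close> bases along \<open>D\<close>. The equal sides lie on three families of parallel lines. Modulo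
the lattice the hits with a family are evenly spread along its lines, and two thirds of each line
are tile edges, so about two thirds of the hits count. The rounding errors of the
three families nearly cancel: \<open>3E\<close> differs from \<open>2(2a + b) + 6b\<close> by less than \<open>3\<close>
(\<open>short_edge_hits\<close>). This leaves at most two values of \<open>E\<close>, and the period is \<open>2b + E\<close> for even \<open>E\<close>
and \<open>2(2b + E)\<close> for odd \<open>E\<close>.\<close>

section \<open>The lattice and its symmetry group\<close>

definition omega :: complex  (\<open>\<omega>\<close>) where
  "\<omega> = Complex (1/2) (sqrt 3 / 2)"

text \<open>The coordinates of a point with respect to the real basis \<open>1, \<omega>\<close>.\<close>
definition eca :: "complex \<Rightarrow> real" where "eca z = Re z - Im z / sqrt 3"
definition ecb :: "complex \<Rightarrow> real" where "ecb z = 2 * Im z / sqrt 3"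

lemma coords_eqI: "eca z = eca w \<Longrightarrow> ecb z = ecb w \<Longrightarrow> z = w"
  by (simp add: eca_def ecb_def complex_eq_iff)

lemma eca_simps [simp]:
  "eca 0 = 0" "eca 1 = 1" "eca (z + w) = eca z + eca w" "eca (z - w) = eca z - eca w"
  "eca (- z) = - eca z" "eca (r *\<^sub>R z) = r * eca z" "eca (cnj z) = eca z + ecb z"
  "eca (\<omega> * z) = - ecb z"
  by (simp_all add: eca_def ecb_def omega_def field_simps)

lemma ecb_simps [simp]:
  "ecb 0 = 0" "ecb 1 = 0" "ecb (z + w) = ecb z + ecb w" "ecb (z - w) = ecb z - ecb w"
  "ecb (- z) = - ecb z" "ecb (r *\<^sub>R z) = r * ecb z" "ecb (cnj z) = - ecb z"
  "ecb (\<omega> * z) = eca z + ecb z"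
  by (simp_all add: eca_def ecb_def omega_def field_simps)

lemma omega_power3: "\<omega> ^ 3 = -1"
  by (simp add: omega_def complex_eq_iff power3_eq_cube field_simps)

lemma cnj_omega: "cnj \<omega> = \<omega> ^ 5"
proof -
  have "\<omega> ^ 5 = \<omega> ^ 3 * (\<omega> * \<omega>)" by (simp add: numeral_eq_Suc)
  then show ?thesis
    by (simp only: omega_power3) (simp add: omega_def complex_eq_iff)
qed

lemma omega_mult_cnj: "\<omega> * cnj \<omega> = 1"
  by (simp add: omega_def complex_eq_iff)

definition lattice :: "complex set" where
  "lattice = {z. eca z \<in> \<int> \<and> ecb z \<in> \<int>}"

lemma lattice_closed:
  "0 \<in> lattice" "z \<in> lattice \<Longrightarrow> w \<in> lattice \<Longrightarrow> z + w \<in> lattice"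
  "z \<in> lattice \<Longrightarrow> - z \<in> lattice" 
  "z \<in> lattice \<Longrightarrow> \<omega> * z \<in> lattice" "z \<in> lattice \<Longrightarrow> cnj z \<in> lattice"
  by (auto simp: lattice_def)

text \<open>The linear parts of the symmetries of the lattice, a dihedral group of order \<open>12\<close>.\<close>
definition dihedral :: "(complex \<Rightarrow> complex) set" where
  "dihedral = {h. \<exists>k. h = (\<lambda>z. \<omega> ^ k * z) \<or> h = (\<lambda>z. \<omega> ^ k * cnj z)}"

lemma dihedral_id: "(\<lambda>z. z) \<in> dihedral"
  by (auto simp: dihedral_def intro!: exI[of _ 0])

lemma dihedral_add: "h \<in> dihedral \<Longrightarrow> h (z + w) = h z + h w"
  by (auto simp: dihedral_def algebra_simps)

lemma dihedral_scaleR: "h \<in> dihedral \<Longrightarrow> h (r *\<^sub>R z) = r *\<^sub>R h z"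
  by (auto simp: dihedral_def)

lemma dihedral_comp:
  assumes "g \<in> dihedral" "h \<in> dihedral"
  shows "(\<lambda>z. g (h z)) \<in> dihedral"
proof -
  obtain i where i: "g = (\<lambda>z. \<omega> ^ i * z) \<or> g = (\<lambda>z. \<omega> ^ i * cnj z)"
    using assms by (auto simp: dihedral_def)
  obtain j where j: "h = (\<lambda>z. \<omega> ^ j * z) \<or> h = (\<lambda>z. \<omega> ^ j * cnj z)"
    using assms by (auto simp: dihedral_def)
  have 1: "\<omega> ^ i * (\<omega> ^ j * z) = \<omega> ^ (i + j) * z" for z by (simp add: power_add)
  have 2: "\<omega> ^ i * (cnj \<omega> ^ j * z) = \<omega> ^ (i + 5 * j) * z" for z
    by (simp add: power_add cnj_omega power_mult)
  show ?thesis
    using i j by (auto simp: dihedral_def 1 2)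
qed

lemma dihedral_inverse:
  assumes "h \<in> dihedral"
  obtains g where "g \<in> dihedral" "\<And>z. g (h z) = z"
proof -
  obtain k where k: "h = (\<lambda>z. \<omega> ^ k * z) \<or> h = (\<lambda>z. \<omega> ^ k * cnj z)"
    using assms by (auto simp: dihedral_def)
  have 1: "\<omega> ^ (5 * k) * (\<omega> ^ k * z) = z" for z
  proof -
    have "\<omega> ^ (5 * k) * \<omega> ^ k = (\<omega> * cnj \<omega>) ^ k"
      by (simp add: cnj_omega power_mult power_mult_distrib)
    then show ?thesis by (simp add: omega_mult_cnj flip: mult.assoc)
  qed
  have 2: "\<omega> ^ k * (cnj \<omega> ^ k * z) = z" for z
    by (simp add: omega_mult_cnj flip: mult.assoc power_mult_distrib)
  show ?thesis
  proof (cases "h = (\<lambda>z. \<omega> ^ k * z)")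
    case True
    then show ?thesis
      by (intro that[of "\<lambda>z. \<omega> ^ (5*k) * z"]) (auto simp: dihedral_def 1)
  next
    case False
    then have "h = (\<lambda>z. \<omega> ^ k * cnj z)" using k by simp
    then show ?thesis
      by (intro that[of "\<lambda>z. \<omega> ^ k * cnj z"]) (auto simp: dihedral_def 2)
  qed
qed

lemma dihedral_invariant:
  assumes "h \<in> dihedral" and "\<And>z. P (\<omega> * z) \<longleftrightarrow> P z" and "\<And>z. P (cnj z) \<longleftrightarrow> P z"
  shows "P (h z) \<longleftrightarrow> P z"
proof -
  have "P (\<omega> ^ k * z) \<longleftrightarrow> P z" for k z
    by (induction k) (auto simp: assms mult.assoc)
  then show ?thesis using assms by (auto simp: dihedral_def)
qed

lemma dihedral_cases:
  assumes "h \<in> dihedral"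
  obtains k where "k < 6" "h = (\<lambda>z. \<omega> ^ k * z) \<or> h = (\<lambda>z. \<omega> ^ k * cnj z)"
proof -
  obtain k where k: "h = (\<lambda>z. \<omega> ^ k * z) \<or> h = (\<lambda>z. \<omega> ^ k * cnj z)"
    using assms by (auto simp: dihedral_def)
  have "\<omega> ^ 6 = (\<omega> ^ 3)\<^sup>2" by (simp flip: power_mult)
  then have 6: "\<omega> ^ 6 = 1" by (simp add: omega_power3)
  have "\<omega> ^ k = \<omega> ^ (6 * (k div 6) + k mod 6)" by simp
  also have "\<dots> = \<omega> ^ (k mod 6)"
    by (simp only: power_add power_mult 6) simp
  finally show ?thesis using k that[of "k mod 6"] by simp
qed

lemma dihedral_lattice: "h \<in> dihedral \<Longrightarrow> z \<in> lattice \<Longrightarrow> h z \<in> lattice"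
proof -
  have "\<omega> ^ k * w \<in> lattice" if "w \<in> lattice" for k w
    using that by (induction k) (auto simp: mult.assoc lattice_closed)
  then show "h \<in> dihedral \<Longrightarrow> z \<in> lattice \<Longrightarrow> h z \<in> lattice"
    by (auto simp: dihedral_def lattice_closed)
qed

text \<open>The interior of the normalised triangle with corners \<open>0\<close>, \<open>1\<close> and \<open>(1 + \<omega>)/3\<close>, followed by its
three open edges.\<close>
definition chamber :: "complex set" where
  "chamber = {z. 0 < ecb z \<and> ecb z < eca z \<and> eca z + 2 * ecb z < 1}"
definition base_edge :: "complex set" where
  "base_edge = {z. ecb z = 0 \<and> 0 < eca z \<and> eca z < 1}"
definition left_edge :: "complex set" where
  "left_edge = {z. eca z = ecb z \<and> 0 < ecb z \<and> 3 * ecb z < 1}"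
definition right_edge :: "complex set" where
  "right_edge = {z. eca z + 2 * ecb z = 1 \<and> 0 < ecb z \<and> 3 * ecb z < 1}"

text \<open>The ten matrices are those elements of the dihedral group, written in coordinates, that neither fix
the triangle nor act as its mirror symmetry. The coordinates of the image lie strictly between \<open>-1\<close> and
\<open>1\<close>, so only the translations with entries \<open>0\<close> and \<open>1\<close> could bring the image back.\<close>
lemma chamber_image_disjoint:
  fixes a b A B :: real and m n :: int
  assumes d: "0 < b" "b < a" "a + 2 * b < 1"
    and d': "0 < B + n" "B + n < A + m" "A + m + 2 * B + 2 * real_of_int n < 1"
    and opts: "(A, B) \<in> {(-b, a+b), (-a-b, a), (-a, -b), (b, -a-b), (a+b, -a),
        (a+b, -b), (b, a), (-a, a+b), (-b, -a), (a, -a-b)}"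
  shows False
proof -
  define M N where "M = real_of_int m" and "N = real_of_int n"
  note d' = d'[folded M_def N_def]
  have o: "A = - b \<and> B = a + b \<or> A = - a - b \<and> B = a \<or> A = - a \<and> B = - b \<or> A = b \<and> B = - a - b \<or>
      A = a + b \<and> B = - a \<or> A = a + b \<and> B = - b \<or> A = b \<and> B = a \<or> A = - a \<and> B = a + b \<or>
      A = - b \<and> B = - a \<or> A = a \<and> B = - a - b"
    using opts by simp
  have 1: "-1 < A" using o d by (elim disjE conjE) linarith+
  have 2: "A < 1" using o d by (elim disjE conjE) linarith+
  have 3: "-1 < B" using o d by (elim disjE conjE) linarith+
  have 4: "B < 1" using o d by (elim disjE conjE) linarith+
  have "-1 < M" using 2 d' by linarith
  moreover have "M < 2" using 1 d' by linarith
  moreover have "-1 < N" using 4 d' by linarith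
  moreover have "N < 2" using 3 d' by linarith
  ultimately have "-1 < m" "m < 2" "-1 < n" "n < 2"
    by (simp_all add: M_def N_def)
  then have "m = 0 \<or> m = 1" "n = 0 \<or> n = 1" by presburger+
  then have "M = 0 \<or> M = 1" "N = 0 \<or> N = 1" by (auto simp: M_def N_def)
  then show False
    using o d d' by (elim disjE conjE) linarith+
qed

text \<open>Distinct tiles do not overlap, so a lattice symmetry that maps one interior point of the triangle to
another one is a symmetry of the triangle: the identity or the reflection in the axis.\<close>
lemma chamber_stabilizer:
  assumes h: "h \<in> dihedral" and l: "l \<in> lattice" and z: "z \<in> chamber" and z': "h z + l \<in> chamber"
  shows "(h = (\<lambda>z. z) \<and> l = 0) \<or> (h = (\<lambda>z. - cnj z) \<and> l = 1)"
proof -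
  obtain m n :: int where mn: "eca l = m" "ecb l = n"
    using l by (auto simp: lattice_def elim!: Ints_cases)
  have c: "0 < ecb z" "ecb z < eca z" "eca z + 2 * ecb z < 1"
    using z by (auto simp: chamber_def)
  have c': "0 < ecb (h z) + n" "ecb (h z) + n < eca (h z) + m"
      "eca (h z) + m + 2 * ecb (h z) + 2 * real_of_int n < 1"
    using z' by (auto simp: chamber_def mn)
  obtain k where k: "k < 6" and hk: "h = (\<lambda>z. \<omega> ^ k * z) \<or> h = (\<lambda>z. \<omega> ^ k * cnj z)"
    using dihedral_cases[OF h] by blast
  define a b where ab: "a = eca z" "b = ecb z"
  have rot: "(k = 0 \<and> eca (\<omega> ^ k * w) = eca w \<and> ecb (\<omega> ^ k * w) = ecb w) \<or>
      (k = 1 \<and> eca (\<omega> ^ k * w) = - ecb w \<and> ecb (\<omega> ^ k * w) = eca w + ecb w) \<or>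
      (k = 2 \<and> eca (\<omega> ^ k * w) = - eca w - ecb w \<and> ecb (\<omega> ^ k * w) = eca w) \<or>
      (k = 3 \<and> eca (\<omega> ^ k * w) = - eca w \<and> ecb (\<omega> ^ k * w) = - ecb w) \<or>
      (k = 4 \<and> eca (\<omega> ^ k * w) = ecb w \<and> ecb (\<omega> ^ k * w) = - eca w - ecb w) \<or>
      (k = 5 \<and> eca (\<omega> ^ k * w) = eca w + ecb w \<and> ecb (\<omega> ^ k * w) = - eca w)" for w
  proof -
    have "k = 0 \<or> k = 1 \<or> k = 2 \<or> k = 3 \<or> k = 4 \<or> k = 5" using k by linarith
    then show ?thesis by (elim disjE) (simp_all add: numeral_eq_Suc mult.assoc)
  qed
  define a b where ab: "a = eca z" "b = ecb z"
  define A B where AB: "A = eca (h z)" "B = ecb (h z)"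
  have opts: "(k = 0 \<and> h = (\<lambda>z. \<omega> ^ k * z) \<and> A = a \<and> B = b) \<or>
      (k = 3 \<and> h = (\<lambda>z. \<omega> ^ k * cnj z) \<and> A = - a - b \<and> B = b) \<or>
      (A, B) \<in> {(-b, a+b), (-a-b, a), (-a, -b), (b, -a-b), (a+b, -a),
        (a+b, -b), (b, a), (-a, a+b), (-b, -a), (a, -a-b)}"
    using hk
  proof
    assume hz: "h = (\<lambda>z. \<omega> ^ k * z)"
    have "h z = \<omega> ^ k * z" by (simp add: hz)
    with rot[of z] hz show ?thesis unfolding AB ab by (elim disjE conjE) simp_all
  next
    assume hz: "h = (\<lambda>z. \<omega> ^ k * cnj z)"
    have "h z = \<omega> ^ k * cnj z" by (simp add: hz)
    with rot[of "cnj z"] hz show ?thesis unfolding AB ab by (elim disjE conjE) simp_all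
  qed
  have d: "0 < b" "b < a" "a + 2 * b < 1" using c ab by auto
  have d': "0 < B + n" "B + n < A + m" "A + m + 2 * B + 2 * real_of_int n < 1"
    using c' AB by auto
  from opts have *: "m = 0 \<and> n = 0 \<and> k = 0 \<and> h = (\<lambda>z. \<omega> ^ k * z)
      \<or> m = 1 \<and> n = 0 \<and> k = 3 \<and> h = (\<lambda>z. \<omega> ^ k * cnj z)"
  proof (elim disjE)
    assume e: "k = 0 \<and> h = (\<lambda>z. \<omega> ^ k * z) \<and> A = a \<and> B = b"
    have "-1 < real_of_int n" "real_of_int n < 1" "-1 < real_of_int m" "real_of_int m < 1"
      using e d d' by linarith+
    then show ?thesis using e by simp
  next
    assume e: "k = 3 \<and> h = (\<lambda>z. \<omega> ^ k * cnj z) \<and> A = - a - b \<and> B = b"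
    have "-1 < real_of_int n" "real_of_int n < 1" "0 < real_of_int m" "real_of_int m < 2"
      using e d d' by linarith+
    then show ?thesis using e by simp
  next
    assume "(A, B) \<in> {(-b, a+b), (-a-b, a), (-a, -b), (b, -a-b), (a+b, -a),
        (a+b, -b), (b, a), (-a, a+b), (-b, -a), (a, -a-b)}"
    then show ?thesis using chamber_image_disjoint[OF d d'] by blast
  qed
  then show ?thesis
    using mn by (auto simp: omega_power3 intro!: coords_eqI)
qed

section \<open>The edges of the tiling\<close>
definition near_int :: "real \<Rightarrow> bool" where
  "near_int r \<longleftrightarrow> (\<exists>k::int. k - 1 / 3 \<le> r \<and> r \<le> k + 1 / 3)"

text \<open>The lines through lattice points in the three directions of the lattice edges.\<close>
definition long_edge :: "complex \<Rightarrow> bool" where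
  "long_edge z \<longleftrightarrow> eca z \<in> \<int> \<or> ecb z \<in> \<int> \<or> eca z + ecb z \<in> \<int>"

text \<open>The three conditions describe the lines of the altitudes of the lattice triangles. In each of them
the second function is an affine parameter that is integral exactly at the lattice points of
the line. The centres divide the piece between two lattice points into thirds. The outer thirds are
edges of tiles; the middle third joins two adjacent centres and is the common axis of symmetry of
two tiles.\<close>
definition short_edge :: "complex \<Rightarrow> bool" where
  "short_edge z \<longleftrightarrow> (2 * eca z + ecb z \<in> \<int> \<and> near_int (eca z)) \<or>
     (ecb z - eca z \<in> \<int> \<and> near_int (eca z)) \<or> (eca z + 2 * ecb z \<in> \<int> \<and> near_int (ecb z))"

text \<open>The lattice points together with the centres of the lattice triangles.\<close>
definition tile_vertex :: "complex \<Rightarrow> bool" where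
  "tile_vertex z \<longleftrightarrow> ecb z - eca z \<in> \<int> \<and> 3 * eca z \<in> \<int>"

lemma near_int_mono:
  assumes "near_int r" "s - r \<in> \<int> \<or> s + r \<in> \<int>" shows "near_int s"
proof -
  obtain k :: int where k: "k - 1/3 \<le> r \<and> r \<le> k + 1/3" using assms by (auto simp: near_int_def)
  from assms(2) show ?thesis
  proof
    assume "s - r \<in> \<int>"
    then obtain j :: int where "s - r = j" by (auto elim: Ints_cases)
    then have "of_int (k + j) - 1/3 \<le> s \<and> s \<le> of_int (k + j) + 1/3" using k by auto
    then show ?thesis unfolding near_int_def by blast
  next
    assume "s + r \<in> \<int>"
    then obtain j :: int where "s + r = j" by (auto elim: Ints_cases)
    then have "of_int (j - k) - 1/3 \<le> s \<and> s \<le> of_int (j - k) + 1/3" using k by auto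
    then show ?thesis unfolding near_int_def by blast
  qed
qed

lemma near_int_cong: "s - r \<in> \<int> \<or> s + r \<in> \<int> \<Longrightarrow> near_int s \<longleftrightarrow> near_int r"
  using near_int_mono[of r s] near_int_mono[of s r] by (metis Ints_minus add.commute minus_diff_eq)

lemma Ints_minus_iff: "- (r::real) \<in> \<int> \<longleftrightarrow> r \<in> \<int>"
  using Ints_minus[of r] Ints_minus[of "-r"] by auto

lemma long_edge_omega: "long_edge (\<omega> * z) \<longleftrightarrow> long_edge z"
  by (auto simp: long_edge_def Ints_minus_iff)
lemma long_edge_cnj: "long_edge (cnj z) \<longleftrightarrow> long_edge z"
  by (auto simp: long_edge_def Ints_minus_iff)

lemma short_edge_omega: "short_edge (\<omega> * z) \<longleftrightarrow> short_edge z"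
proof -
  have 1: "2 * - ecb z + (eca z + ecb z) \<in> \<int> \<and> near_int (- ecb z)
      \<longleftrightarrow> ecb z - eca z \<in> \<int> \<and> near_int (eca z)"
    using near_int_cong[of "- ecb z" "eca z"] Ints_minus_iff[of "ecb z - eca z"]
    by (auto simp: algebra_simps)
  have 2: "(eca z + ecb z) - - ecb z \<in> \<int> \<and> near_int (- ecb z)
      \<longleftrightarrow> eca z + 2 * ecb z \<in> \<int> \<and> near_int (ecb z)"
    using near_int_cong[of "- ecb z" "ecb z"] by (auto simp: algebra_simps)
  have 3: "- ecb z + 2 * (eca z + ecb z) \<in> \<int> \<and> near_int (eca z + ecb z)
      \<longleftrightarrow> 2 * eca z + ecb z \<in> \<int> \<and> near_int (eca z)"
    using near_int_cong[of "eca z + ecb z" "eca z"] by (auto simp: algebra_simps)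
  show ?thesis unfolding short_edge_def eca_simps ecb_simps 1 2 3 by blast
qed

lemma short_edge_cnj: "short_edge (cnj z) \<longleftrightarrow> short_edge z"
proof -
  have 1: "2 * (eca z + ecb z) + - ecb z \<in> \<int> \<and> near_int (eca z + ecb z)
      \<longleftrightarrow> 2 * eca z + ecb z \<in> \<int> \<and> near_int (eca z)"
    using near_int_cong[of "eca z + ecb z" "eca z"] by (auto simp: algebra_simps)
  have 2: "- ecb z - (eca z + ecb z) \<in> \<int> \<and> near_int (eca z + ecb z)
      \<longleftrightarrow> eca z + 2 * ecb z \<in> \<int> \<and> near_int (ecb z)"
    using near_int_cong[of "eca z + ecb z" "ecb z"] Ints_minus_iff[of "eca z + 2 * ecb z"]
    by (auto simp: algebra_simps)
  have 3: "(eca z + ecb z) + 2 * - ecb z \<in> \<int> \<and> near_int (- ecb z)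
      \<longleftrightarrow> ecb z - eca z \<in> \<int> \<and> near_int (eca z)"
    using near_int_cong[of "- ecb z" "eca z"] Ints_minus_iff[of "ecb z - eca z"]
    by (auto simp: algebra_simps)
  show ?thesis unfolding short_edge_def eca_simps ecb_simps 1 2 3 by blast
qed

lemma tile_vertex_omega: "tile_vertex (\<omega> * z) \<longleftrightarrow> tile_vertex z"
proof
  assume "tile_vertex (\<omega> * z)"
  then have v: "eca z + 2 * ecb z \<in> \<int>" "3 * ecb z \<in> \<int>"
    by (auto simp: tile_vertex_def Ints_minus_iff algebra_simps)
  have "ecb z - eca z = 3 * ecb z - (eca z + 2 * ecb z)" 
    "3 * eca z = 3 * (eca z + 2 * ecb z) - 2 * (3 * ecb z)" by simp_all
  then show "tile_vertex z" using v unfolding tile_vertex_def by (metis Ints_diff Ints_mult Ints_numeral)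
next
  assume "tile_vertex z"
  then have v: "ecb z - eca z \<in> \<int>" "3 * eca z \<in> \<int>" by (auto simp: tile_vertex_def)
  have "eca z + ecb z - - ecb z = 2 * (ecb z - eca z) + 3 * eca z" 
    "3 * - ecb z = - (3 * (ecb z - eca z) + 3 * eca z)" by simp_all
  then show "tile_vertex (\<omega> * z)" using v unfolding tile_vertex_def eca_simps ecb_simps
    by (metis Ints_add Ints_minus Ints_mult Ints_numeral)
qed

lemma tile_vertex_cnj: "tile_vertex (cnj z) \<longleftrightarrow> tile_vertex z"
proof
  assume "tile_vertex (cnj z)"
  then have v: "- ecb z - (eca z + ecb z) \<in> \<int>" "3 * (eca z + ecb z) \<in> \<int>"
    by (auto simp: tile_vertex_def)
  have "ecb z - eca z = - (3 * (eca z + ecb z) + 2 * (- ecb z - (eca z + ecb z)))" 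
    "3 * eca z = 3 * (- ecb z - (eca z + ecb z)) + 2 * (3 * (eca z + ecb z))" by simp_all
  then show "tile_vertex z" using v unfolding tile_vertex_def by (metis Ints_add Ints_minus Ints_mult Ints_numeral)
next
  assume "tile_vertex z"
  then have v: "ecb z - eca z \<in> \<int>" "3 * eca z \<in> \<int>" by (auto simp: tile_vertex_def)
  have "- ecb z - (eca z + ecb z) = - (2 * (ecb z - eca z) + 3 * eca z)" 
    "3 * (eca z + ecb z) = 3 * (ecb z - eca z) + 2 * (3 * eca z)" by simp_all
  then show "tile_vertex (cnj z)" using v unfolding tile_vertex_def eca_simps ecb_simps
    by (metis Ints_add Ints_minus Ints_mult Ints_numeral)
qed

lemma Ints_add_iff: "r \<in> \<int> \<Longrightarrow> s + r \<in> \<int> \<longleftrightarrow> (s::real) \<in> \<int>"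
  by (metis Ints_add Ints_diff add_diff_cancel)

lemma lattice_translate:
  assumes "l \<in> lattice"
  shows "long_edge (z + l) \<longleftrightarrow> long_edge z" "short_edge (z + l) \<longleftrightarrow> short_edge z"
    "tile_vertex (z + l) \<longleftrightarrow> tile_vertex z"
proof -
  obtain m n :: int where mn: "eca l = m" "ecb l = n"
    using assms by (auto simp: lattice_def elim!: Ints_cases)
  have cong: "r \<in> \<int> \<longleftrightarrow> s \<in> \<int>" if "r - s = of_int k" for r s :: real and k :: int
    using that Ints_add_iff[of "of_int k" s] by (metis Ints_of_int add.commute diff_add_cancel)
  have 1: "eca z + m \<in> \<int> \<longleftrightarrow> eca z \<in> \<int>" by (rule cong[of _ _ m]) simp
  have 2: "ecb z + n \<in> \<int> \<longleftrightarrow> ecb z \<in> \<int>" by (rule cong[of _ _ n]) simp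
  have 3: "eca z + m + (ecb z + n) \<in> \<int> \<longleftrightarrow> eca z + ecb z \<in> \<int>" by (rule cong[of _ _ "m+n"]) simp
  have 4: "2 * (eca z + m) + (ecb z + n) \<in> \<int> \<longleftrightarrow> 2 * eca z + ecb z \<in> \<int>"
    by (rule cong[of _ _ "2*m+n"]) simp
  have 5: "ecb z + n - (eca z + m) \<in> \<int> \<longleftrightarrow> ecb z - eca z \<in> \<int>"
    by (rule cong[of _ _ "n-m"]) simp
  have 6: "eca z + m + 2 * (ecb z + n) \<in> \<int> \<longleftrightarrow> eca z + 2 * ecb z \<in> \<int>"
    by (rule cong[of _ _ "m+2*n"]) simp
  have 7: "3 * (eca z + m) \<in> \<int> \<longleftrightarrow> 3 * eca z \<in> \<int>" by (rule cong[of _ _ "3*m"]) simp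
  have 8: "near_int (eca z + m) = near_int (eca z)" "near_int (ecb z + n) = near_int (ecb z)"
    by (rule near_int_cong; simp)+
  show "long_edge (z + l) \<longleftrightarrow> long_edge z" "short_edge (z + l) \<longleftrightarrow> short_edge z"
    "tile_vertex (z + l) \<longleftrightarrow> tile_vertex z"
    by (simp_all only: long_edge_def short_edge_def tile_vertex_def eca_simps ecb_simps mn 1 2 3 4 5 6 7 8)
qed

lemma tiling_invariant:
  assumes "h \<in> dihedral" "l \<in> lattice"
  shows "long_edge (h z + l) \<longleftrightarrow> long_edge z" "short_edge (h z + l) \<longleftrightarrow> short_edge z"
    "tile_vertex (h z + l) \<longleftrightarrow> tile_vertex z"
  using assms
  by (simp_all add: lattice_translate dihedral_invariant[where P = long_edge]
      dihedral_invariant[where P = short_edge] dihedral_invariant[where P = tile_vertex]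
      long_edge_omega long_edge_cnj short_edge_omega short_edge_cnj tile_vertex_omega tile_vertex_cnj)

lemma not_Ints_between: "of_int k < r \<Longrightarrow> r < of_int k + 1 \<Longrightarrow> r \<notin> (\<int> :: real set)"
  by (auto elim!: Ints_cases)

lemma half_near_int:
  assumes "2 * r \<in> \<int>" "near_int r" shows "r \<in> \<int>"
proof -
  obtain j :: int where j: "2 * r = j" using assms by (auto elim: Ints_cases)
  obtain k :: int where k: "k - 1/3 \<le> r \<and> r \<le> k + 1/3" using assms by (auto simp: near_int_def)
  from j k have "real_of_int (j - 2 * k) < 1" "-1 < real_of_int (j - 2 * k)" by simp_all
  then have "j = 2 * k" by linarith
  with j show ?thesis by simp
qed

lemma chamber_no_edge:
  assumes "z \<in> chamber" shows "\<not> long_edge z" "\<not> short_edge z" "\<not> tile_vertex z"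
proof -
  have c: "0 < ecb z" "ecb z < eca z" "eca z + 2 * ecb z < 1"
    using assms by (auto simp: chamber_def)
  have l: "eca z \<notin> \<int>" "ecb z \<notin> \<int>" "eca z + ecb z \<notin> \<int>" "eca z + 2 * ecb z \<notin> \<int>"
    by (rule not_Ints_between[of 0]; use c in simp)+
  have d: "ecb z - eca z \<notin> \<int>" by (rule not_Ints_between[of "-1"]; use c in simp)
  have e: "\<not> near_int (eca z)" if i: "2 * eca z + ecb z \<in> \<int>"
  proof
    assume "near_int (eca z)"
    then obtain k :: int where k: "k - 1/3 \<le> eca z" "eca z \<le> k + 1/3" by (auto simp: near_int_def)
    obtain j :: int where j: "2 * eca z + ecb z = j" using i by (auto elim: Ints_cases)
    have "j = 1" using j c by linarith
    with j have s: "2 * eca z + ecb z = 1" by simp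
    have "k = 0 \<or> k = 1" using k c by linarith
    then show False
    proof
      assume "k = 0" with k have "3 * eca z \<le> 1" by simp
      with s c show False by linarith
    next
      assume "k = 1" with k have "2 \<le> 3 * eca z" by simp
      with s c show False by linarith
    qed
  qed
  show "\<not> long_edge z" "\<not> short_edge z" "\<not> tile_vertex z"
    using l d e by (auto simp: long_edge_def short_edge_def tile_vertex_def)
qed

lemma base_edge_tiling:
  assumes "z \<in> base_edge" shows "long_edge z" "\<not> tile_vertex z"
proof -
  have "- eca z \<notin> \<int>" by (rule not_Ints_between[of "-1"]; use assms in \<open>simp add: base_edge_def\<close>)
  then show "long_edge z" "\<not> tile_vertex z"
    using assms by (simp_all add: long_edge_def tile_vertex_def base_edge_def)
qed

lemma side_edge_tiling:
  assumes "z \<in> left_edge \<union> right_edge" shows "short_edge z" "\<not> tile_vertex z"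
proof -
  have n: "near_int (ecb z)"
    using assms by (auto simp: left_edge_def right_edge_def near_int_def intro!: exI[of _ 0])
  have "3 * ecb z \<notin> \<int>"
    by (rule not_Ints_between[of 0]; use assms in \<open>auto simp: left_edge_def right_edge_def\<close>)
  moreover have "3 * ecb z = 3 * eca z \<or> 3 * ecb z = 1 + (ecb z - eca z)"
    using assms by (auto simp: left_edge_def right_edge_def)
  ultimately have "\<not> tile_vertex z"
    unfolding tile_vertex_def by (metis Ints_1 Ints_add)
  then show "short_edge z" "\<not> tile_vertex z"
    using assms n by (auto simp: short_edge_def left_edge_def right_edge_def)
qed

lemma Ints_combination:
  assumes "p \<in> \<int>" "q \<in> \<int>" "r = of_int m * p + of_int n * q" shows "(r::real) \<in> \<int>"
  unfolding assms(3) by (intro Ints_add Ints_mult Ints_of_int assms(1,2))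

text \<open>An altitude also meets a lattice edge at its midpoint, but the midpoint lies on the middle third of
the altitude.\<close>
lemma long_short_edge_vertex:
  assumes "long_edge z" "short_edge z" shows "tile_vertex z"
proof -
  define a b where "a = eca z" and "b = ecb z"
  have l: "a \<in> \<int> \<or> b \<in> \<int> \<or> a + b \<in> \<int>" using assms by (auto simp: long_edge_def a_def b_def)
  have s: "2*a+b \<in> \<int> \<and> near_int a \<or> b-a \<in> \<int> \<and> near_int a \<or> a+2*b \<in> \<int> \<and> near_int b"
    using assms by (auto simp: short_edge_def a_def b_def)
  have "a \<in> \<int> \<and> b \<in> \<int> \<or> (a \<in> \<int> \<and> 2 * b \<in> \<int> \<and> near_int b) \<or>
      (b \<in> \<int> \<and> 2 * a \<in> \<int> \<and> near_int a) \<or> (a + b \<in> \<int> \<and> 2 * a \<in> \<int> \<and> near_int a)"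
  proof -
    from l s show ?thesis
    proof (elim disjE conjE)
      assume "a \<in> \<int>" "2*a+b \<in> \<int>"
      moreover from Ints_combination[OF this, of b "-2" 1] have "b \<in> \<int>" by simp
      ultimately show ?thesis by blast
    next
      assume "a \<in> \<int>" "b-a \<in> \<int>"
      moreover from Ints_combination[OF this, of b 1 1] have "b \<in> \<int>" by simp
      ultimately show ?thesis by blast
    next
      assume "a \<in> \<int>" "a+2*b \<in> \<int>" "near_int b"
      moreover from Ints_combination[OF this(1,2), of "2*b" "-1" 1] have "2*b \<in> \<int>" by simp
      ultimately show ?thesis by blast
    next
      assume "b \<in> \<int>" "2*a+b \<in> \<int>" "near_int a"
      moreover from Ints_combination[OF this(1,2), of "2*a" "-1" 1] have "2*a \<in> \<int>" by simp
      ultimately show ?thesis by blast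
    next
      assume "b \<in> \<int>" "b-a \<in> \<int>"
      moreover from Ints_combination[OF this, of a 1 "-1"] have "a \<in> \<int>" by simp
      ultimately show ?thesis by blast
    next
      assume "b \<in> \<int>" "a+2*b \<in> \<int>"
      moreover from Ints_combination[OF this, of a "-2" 1] have "a \<in> \<int>" by simp
      ultimately show ?thesis by blast
    next
      assume ab: "a+b \<in> \<int>" "2*a+b \<in> \<int>"
      from Ints_combination[OF ab, of a "-1" 1] Ints_combination[OF ab, of b 2 "-1"] have "a \<in> \<int>" "b \<in> \<int>" by simp_all
      then show ?thesis by blast
    next
      assume "a+b \<in> \<int>" "b-a \<in> \<int>" "near_int a"
      moreover from Ints_combination[OF this(1,2), of "2*a" 1 "-1"] have "2*a \<in> \<int>" by simp
      ultimately show ?thesis by blast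
    next
      assume ab: "a+b \<in> \<int>" "a+2*b \<in> \<int>"
      from Ints_combination[OF ab, of a 2 "-1"] Ints_combination[OF ab, of b "-1" 1] have "a \<in> \<int>" "b \<in> \<int>" by simp_all
      then show ?thesis by blast
    qed
  qed
  then have "a \<in> \<int> \<and> b \<in> \<int>"
    using half_near_int[of a] half_near_int[of b] Ints_diff[of "a + b" a] unfolding add_diff_cancel_left' by blast
  then show ?thesis unfolding tile_vertex_def a_def b_def by (blast intro: Ints_diff Ints_mult Ints_numeral)
qed

section \<open>Counting the edges crossed along a lattice vector\<close>
lemma line_hits_integers:
  fixes c :: real and m :: int
  assumes "0 < m"
  shows "finite {s \<in> {0<..1::real}. c + s * real_of_int m \<in> \<int>}" "card {s \<in> {0<..1::real}. c + s * real_of_int m \<in> \<int>} = nat m"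
proof -
  have "bij_betw (\<lambda>k::int. (k - c) / m) {\<lfloor>c\<rfloor> + 1..\<lfloor>c\<rfloor> + m} {s \<in> {0<..1::real}. c + s * real_of_int m \<in> \<int>}"
  proof (rule bij_betw_byWitness[where f' = "\<lambda>s. \<lfloor>c + s * real_of_int m\<rfloor>"])
    show "(\<lambda>k::int. (k - c) / m) ` {\<lfloor>c\<rfloor> + 1..\<lfloor>c\<rfloor> + m} \<subseteq> {s \<in> {0<..1::real}. c + s * real_of_int m \<in> \<int>}"
    proof (intro image_subsetI)
      fix k assume "k \<in> {\<lfloor>c\<rfloor> + 1..\<lfloor>c\<rfloor> + m}"
      then have "c < real_of_int k" "real_of_int k \<le> c + real_of_int m" by (auto, linarith+)
      then show "(real_of_int k - c) / real_of_int m \<in> {s \<in> {0<..1::real}. c + s * real_of_int m \<in> \<int>}"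
        using assms by (auto simp: field_simps)
    qed
    show "(\<lambda>s::real. \<lfloor>c + s * real_of_int m\<rfloor>) ` {s \<in> {0<..1::real}. c + s * real_of_int m \<in> \<int>} \<subseteq> {\<lfloor>c\<rfloor> + 1..\<lfloor>c\<rfloor> + m}"
    proof (intro image_subsetI)
      fix s :: real assume "s \<in> {s \<in> {0<..1::real}. c + s * real_of_int m \<in> \<int>}"
      then obtain k :: int where k: "c + s * real_of_int m = k" and s: "0 < s" "s \<le> 1"
        by (auto elim!: Ints_cases)
      have "0 < s * real_of_int m" "s * real_of_int m \<le> m" using s assms by auto
      then have "c < k" "k \<le> c + m" using k by linarith+
      then have "\<lfloor>c\<rfloor> < k \<and> k \<le> \<lfloor>c\<rfloor> + m" by linarith
      then show "\<lfloor>c + s * real_of_int m\<rfloor> \<in> {\<lfloor>c\<rfloor> + 1..\<lfloor>c\<rfloor> + m}" unfolding k by auto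
    qed
  qed (use assms in \<open>auto elim!: Ints_cases simp: field_simps\<close>)
  from bij_betw_finite[OF this] bij_betw_same_card[OF this]
  show "finite {s \<in> {0<..1::real}. c + s * real_of_int m \<in> \<int>}" "card {s \<in> {0<..1::real}. c + s * real_of_int m \<in> \<int>} = nat m"
    by auto
qed

lemma near_int_round:
  assumes "near_int r" shows "\<bar>r - round r\<bar> \<le> 1/3"
proof -
  obtain k :: int where k: "k - 1/3 \<le> r" "r \<le> k + 1/3" using assms by (auto simp: near_int_def)
  then have "\<bar>r - k\<bar> < 1/2" by linarith
  then have "round r = k" by (rule round_unique')
  then show ?thesis using k unfolding abs_le_iff by simp
qed

text \<open>If \<open>f + s m = k\<close>, then \<open>g + s n = (K + n k) / m\<close>, where \<open>K\<close> depends only on the line. The point is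
within \<open>1/3\<close> of the integer \<open>l\<close> exactly if \<open>j = n k - m l\<close> satisfies \<open>\<bar>K + j\<bar> \<le> m/3\<close>. As \<open>k\<close> runs through
a residue system modulo \<open>m\<close>, every integer \<open>j\<close> arises from exactly one pair \<open>(k, l)\<close>. So the hits are
counted by the integers of an interval of length \<open>2m/3\<close>.\<close>
lemma line_hits_near_integers:
  fixes f g K :: real and m n :: int
  assumes m: "0 < m" and co: "coprime m n"
  defines "S \<equiv> {s \<in> {0<..1::real}. f + s * real_of_int m \<in> \<int> \<and> near_int (g + s * real_of_int n)}"
    and "K \<equiv> m * g - n * f"
  shows "finite S" "int (card S) = \<lfloor>m / 3 - K\<rfloor> + \<lfloor>m / 3 + K\<rfloor> + 1"
    "\<And>j::int. \<bar>K + j\<bar> \<le> m / 3 \<Longrightarrow> \<exists>s\<in>{0<..1::real}. \<exists>k l. f + s * real_of_int m = of_int k \<and>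
        g + s * real_of_int n = of_int l + (K + j) / m"
proof -
  define J where "J = {j::int. \<bar>K + j\<bar> \<le> m / 3}"
  have m0: "real_of_int m > 0" using m by simp
  define \<phi> where "\<phi> = (\<lambda>s::real. n * \<lfloor>f + s * real_of_int m\<rfloor> - m * round (g + s * real_of_int n))"
  have rel: "g + s * real_of_int n = (K + n * k) / m" if "f + s * real_of_int m = of_int k" for s :: real and k :: int
  proof -
    have "s = (k - f) / m" using that m0 by (simp add: field_simps)
    then show ?thesis using m0 by (simp add: K_def field_simps flip: that)
  qed
  have into: "\<phi> s \<in> J" if s: "s \<in> S" for s
  proof -
    obtain k where k: "f + s * real_of_int m = of_int k" using s by (auto simp: S_def elim: Ints_cases)
    define l where "l = round (g + s * real_of_int n)"
    have "\<bar>g + s * real_of_int n - l\<bar> \<le> 1/3" unfolding l_def using s by (intro near_int_round) (simp add: S_def)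
    then have "\<bar>(K + n * k) / m - l\<bar> \<le> 1/3" using rel[OF k] by simp
    also have "(K + n * k) / m - l = (K + (n * k - m * l)) / m" using m0 by (simp add: field_simps)
    finally have "\<bar>K + (n * k - m * l)\<bar> \<le> m / 3" using m0 by (simp add: abs_divide field_simps)
    then show ?thesis by (simp add: J_def \<phi>_def k l_def)
  qed
  have inj: "inj_on \<phi> S"
  proof
    fix s s' assume s: "s \<in> S" and s': "s' \<in> S" and eq: "\<phi> s = \<phi> s'"
    obtain k where k: "f + s * real_of_int m = of_int k" using s by (auto simp: S_def elim: Ints_cases)
    obtain k' where k': "f + s' * real_of_int m = of_int k'" using s' by (auto simp: S_def elim: Ints_cases)
    have "n * (k - k') = m * (round (g + s * real_of_int n) - round (g + s' * real_of_int n))"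
      using eq by (simp add: \<phi>_def k k' algebra_simps)
    then have "m dvd n * (k - k')" by simp
    then have dvd: "m dvd k - k'" using co by (simp add: coprime_dvd_mult_right_iff)
    have "\<bar>s - s'\<bar> < 1" using s s' by (auto simp: S_def)
    then have "\<bar>s - s'\<bar> * real_of_int m < 1 * real_of_int m"
      using m0 by (intro mult_strict_right_mono)
    moreover have "\<bar>s - s'\<bar> * real_of_int m = \<bar>(s - s') * real_of_int m\<bar>"
      using m0 by (simp add: abs_mult)
    moreover have "(s - s') * real_of_int m = of_int (k - k')"
      using k k' by (simp add: algebra_simps)
    ultimately have "\<bar>k - k'\<bar> < m" by linarith
    then have "k = k'" using dvd by (metis abs_of_pos dvd_imp_le_int eq_iff_diff_eq_0 linorder_not_le m)
    then have "s * real_of_int m = s' * real_of_int m" using k k' by linarith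
    then show "s = s'" using m by simp
  qed
  have ex: "\<exists>s\<in>{0<..1::real}. \<exists>k l. f + s * real_of_int m = of_int k \<and> g + s * real_of_int n = of_int l + (K + j) / m \<and> n * k - m * l = j"
    for j :: int
  proof -
    obtain u v where uv: "u * m + v * n = 1" using co by (metis bezout_int coprime_iff_gcd_eq_1)
    \<comment> \<open>The shift by \<open>t\<close> periods moves \<open>k\<close> into the window \<open>f < k \<le> f + m\<close>.\<close>
    define t where "t = \<lfloor>(f + m - v * j) / m\<rfloor>"
    define k l where "k = v * j + m * t" and "l = - u * j + n * t"
    have j: "n * k - m * l = j"
    proof -
      have "n * k - m * l = (u * m + v * n) * j" by (simp add: k_def l_def algebra_simps)
      then show ?thesis by (simp add: uv)
    qed
    have "of_int t \<le> (f + m - v * j) / m" "(f + m - v * j) / m < of_int t + 1"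
      unfolding t_def by linarith+
    then have "t * real_of_int m \<le> f + m - v * j" "f + m - v * j < (t + 1) * real_of_int m"
      using m0 by (simp_all add: pos_le_divide_eq pos_divide_less_eq)
    then have kf: "f < k" "k \<le> f + m" by (simp_all add: k_def algebra_simps)
    define s where "s = (k - f) / m"
    have "s \<in> {0<..1::real}" using kf m0 by (simp add: s_def)
    moreover have fk: "f + s * real_of_int m = of_int k" using m0 by (simp add: s_def)
    moreover have "g + s * real_of_int n = of_int l + (K + j) / m"
      using rel[OF fk] m0 by (simp add: field_simps flip: j)
    ultimately show ?thesis using j by blast
  qed
  then show "\<And>j::int. \<bar>K + j\<bar> \<le> m / 3 \<Longrightarrow> \<exists>s\<in>{0<..1::real}. \<exists>k l. f + s * real_of_int m = of_int k \<and>
        g + s * real_of_int n = of_int l + (K + j) / m" by blast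
  have surj: "J \<subseteq> \<phi> ` S"
  proof
    fix j assume j: "j \<in> J"
    obtain s k l where s: "s \<in> {0<..1::real}" and fk: "f + s * real_of_int m = of_int k"
      and gl: "g + s * real_of_int n = of_int l + (K + j) / m" and eq: "n * k - m * l = j"
      using ex[of j] by blast
    have small: "\<bar>g + s * real_of_int n - l\<bar> \<le> 1/3" 
    proof -
      have "g + s * real_of_int n - l = (K + j) / m" using gl by simp
      moreover have "\<bar>(K + j) / m\<bar> \<le> 1/3" using j m0 by (simp add: J_def abs_divide field_simps)
      ultimately show ?thesis by simp
    qed
    then have "near_int (g + s * real_of_int n)" unfolding near_int_def by (intro exI[of _ l]) linarith
    then have "s \<in> S" using s fk by (simp add: S_def)
    moreover have "round (g + s * real_of_int n) = l" using small by (intro round_unique') linarith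
    ultimately show "j \<in> \<phi> ` S" using fk eq by (intro image_eqI[of _ _ s]) (simp_all add: \<phi>_def)
  qed
  have bij: "bij_betw \<phi> S J" unfolding bij_betw_def using into inj surj by blast
  have J: "J = {- \<lfloor>m / 3 + K\<rfloor>..\<lfloor>m / 3 - K\<rfloor>}"
  proof (intro set_eqI)
    fix j :: int
    have "j \<in> J \<longleftrightarrow> - j \<le> m / 3 + K \<and> j \<le> m / 3 - K"
      unfolding J_def mem_Collect_eq abs_le_iff by (rule iffI; elim conjE; intro conjI; linarith)
    also have "\<dots> \<longleftrightarrow> - j \<le> \<lfloor>m / 3 + K\<rfloor> \<and> j \<le> \<lfloor>m / 3 - K\<rfloor>"
      unfolding le_floor_iff by simp
    finally show "j \<in> J \<longleftrightarrow> j \<in> {- \<lfloor>m / 3 + K\<rfloor>..\<lfloor>m / 3 - K\<rfloor>}" by auto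
  qed
  then have "finite J" by simp
  then show "finite S" using bij_betw_finite[OF bij] by simp
  have "-1 \<le> \<lfloor>m / 3 - K\<rfloor> + \<lfloor>m / 3 + K\<rfloor>" using m0 by linarith
  then show "int (card S) = \<lfloor>m / 3 - K\<rfloor> + \<lfloor>m / 3 + K\<rfloor> + 1"
    unfolding bij_betw_same_card[OF bij] J by simp
qed

lemma floor_noninteger:
  assumes "r \<notin> \<int>" shows "of_int \<lfloor>r\<rfloor> < r" "r < of_int \<lfloor>r\<rfloor> + (1::real)"
  using assms by (metis Ints_of_int less_eq_real_def of_int_floor_le, linarith)

text \<open>Here \<open>c m\<close> counts the integers at distance at most \<open>m/3\<close> from \<open>\<kappa>\<close>. Modulo \<open>3\<close> the three arguments
are \<open>X\<close>, \<open>X\<close> and \<open>2X\<close>, and \<open>c (m + 3) = c m + 2\<close>, so everything reduces to \<open>c 0\<close>, \<open>c 1\<close> and \<open>c 2\<close>. The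
non-integrality of \<open>X/3 \<plusminus> \<kappa>\<close> gives \<open>c 0 = 0\<close> if \<open>3\<close> divides \<open>X\<close>; otherwise it gives
\<open>c 1 + c 2 = 2\<close> with \<open>c 1 \<in> {0, 1}\<close>, which is where the errors of the families cancel.\<close>
lemma three_family_floor_sum:
  fixes \<kappa> :: real and a b X :: int
  assumes X: "X = 2 * a + b" and n1: "X / 3 - \<kappa> \<notin> \<int>" and n2: "X / 3 + \<kappa> \<notin> \<int>"
  defines "c \<equiv> \<lambda>m::int. \<lfloor>m / 3 - \<kappa>\<rfloor> + \<lfloor>m / 3 + \<kappa>\<rfloor> + 1"
  shows "\<bar>3 * (c (2 * a + b) + c (b - a) + c (a + 2 * b)) - (2 * X + 6 * b)\<bar> < 3"
proof -
  define q r where "q = X div 3" and "r = X mod 3"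
  have qr: "X = 3 * q + r" by (simp add: q_def r_def)
  have r: "r = 0 \<or> r = 1 \<or> r = 2" unfolding r_def by presburger
  have shift: "c (3 * i + j) = 2 * i + c j" for i j :: int
  proof -
    have "of_int (3 * i + j) / 3 - \<kappa> = of_int i + (j / 3 - \<kappa>)" "of_int (3 * i + j) / 3 + \<kappa> = of_int i + (j / 3 + \<kappa>)"
      by (simp_all add: field_simps)
    then show ?thesis unfolding c_def by (simp only: int_add_floor[symmetric])
  qed
  have c1: "c (2 * a + b) = 2 * q + c r" using shift[of q r] by (simp add: qr flip: X)
  have b: "b = 3 * q + r - 2 * a" using X qr by simp
  have c2: "c (b - a) = 2 * (q - a) + c r" using shift[of "q - a" r] by (simp add: b algebra_simps)
  have c3: "c (a + 2 * b) = 2 * (2 * q - a) + c (2 * r)"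
    using shift[of "2 * q - a" "2 * r"] by (simp add: b algebra_simps)
  have ri: "r / 3 - \<kappa> \<notin> \<int>" "r / 3 + \<kappa> \<notin> \<int>"
  proof -
    have "X / 3 - \<kappa> = of_int q + (r / 3 - \<kappa>)" "X / 3 + \<kappa> = of_int q + (r / 3 + \<kappa>)"
      by (simp_all add: qr field_simps)
    then show "r / 3 - \<kappa> \<notin> \<int>" "r / 3 + \<kappa> \<notin> \<int>" using n1 n2 by (metis Ints_add Ints_of_int)+
  qed
  have key: "(r = 0 \<and> c r = 0) \<or> (r = 1 \<and> c 1 + c 2 = 2 \<and> 0 \<le> c 1 \<and> c 1 \<le> 1) \<or>
     (r = 2 \<and> c 1 + c 2 = 2 \<and> 0 \<le> c 1 \<and> c 1 \<le> 1)"
  proof -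
    have zero: "c r = 0" if "r = 0"
    proof -
      have "\<kappa> \<notin> \<int>" using ri that by simp
      then have "of_int \<lfloor>\<kappa>\<rfloor> < \<kappa>" "\<kappa> < of_int \<lfloor>\<kappa>\<rfloor> + 1" by (rule floor_noninteger)+
      then have "\<lfloor>- \<kappa>\<rfloor> = - \<lfloor>\<kappa>\<rfloor> - 1" by (intro floor_unique) (simp_all, linarith?)
      then show ?thesis by (simp add: c_def that)
    qed
    have other: "c 1 + c 2 = 2 \<and> 0 \<le> c 1 \<and> c 1 \<le> 1"
      if n: "1/3 - \<kappa> \<notin> \<int>" "1/3 + \<kappa> \<notin> \<int>" "2/3 - \<kappa> \<notin> \<int>" "2/3 + \<kappa> \<notin> \<int>"
    proof -
      note f = floor_noninteger[OF n(1)] floor_noninteger[OF n(2)] floor_noninteger[OF n(3)] floor_noninteger[OF n(4)]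
      have 1: "\<lfloor>1/3 - \<kappa>\<rfloor> + \<lfloor>2/3 + \<kappa>\<rfloor> = 0" using f(1,2,7,8) by linarith
      have 2: "\<lfloor>1/3 + \<kappa>\<rfloor> + \<lfloor>2/3 - \<kappa>\<rfloor> = 0" using f(3,4,5,6) by linarith
      have 3: "\<lfloor>1/3 - \<kappa>\<rfloor> + \<lfloor>1/3 + \<kappa>\<rfloor> \<in> {-1, 0}" using f(1-4) by (simp; linarith)
      show ?thesis using 1 2 3 by (auto simp: c_def)
    qed
    have swap: "(2/3 - \<kappa> \<in> \<int>) = (1/3 + \<kappa> \<in> \<int>)" "(2/3 + \<kappa> \<in> \<int>) = (1/3 - \<kappa> \<in> \<int>)"
    proof -
      have "2/3 - \<kappa> = 1 - (1/3 + \<kappa>)" "1/3 + \<kappa> = 1 - (2/3 - \<kappa>)" "2/3 + \<kappa> = 1 - (1/3 - \<kappa>)"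
        "1/3 - \<kappa> = 1 - (2/3 + \<kappa>)" by simp_all
      then show "(2/3 - \<kappa> \<in> \<int>) = (1/3 + \<kappa> \<in> \<int>)" "(2/3 + \<kappa> \<in> \<int>) = (1/3 - \<kappa> \<in> \<int>)"
        by (metis Ints_1 Ints_diff)+
    qed
    show ?thesis using r
    proof (elim disjE)
      assume "r = 0" with zero show ?thesis by simp
    next
      assume "r = 1" with other ri swap show ?thesis by simp
    next
      assume "r = 2" with other ri swap show ?thesis by simp
    qed
  qed
  have four: "c 4 = 2 + c 1" using shift[of 1 1] by simp
  have sum: "c (2 * a + b) + c (b - a) + c (a + 2 * b) = 8 * q - 4 * a + (2 * c r + c (2 * r))"
    using c1 c2 c3 by simp
  have target: "2 * X + 6 * b = 24 * q - 12 * a + 8 * r" using b qr by simp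
  show ?thesis
    unfolding sum target using key four by (elim disjE conjE) simp_all
qed

lemma card_disjoint_union3:
  assumes "finite S" "finite T" "finite U" "S \<inter> T = {}" "S \<inter> U = {}" "T \<inter> U = {}"
  shows "finite (S \<union> T \<union> U)" "card (S \<union> T \<union> U) = card S + card T + card U"
  using assms by (simp_all add: card_Un_disjoint Int_Un_distrib2)

text \<open>The line meets the three families of lattice lines \<open>-a\<close>, \<open>b\<close> and \<open>a + b\<close> times, and no point is
counted twice because lines of different families meet only in vertices.\<close>
lemma long_edge_hits:
  fixes a b :: int and z D :: complex
  assumes D: "eca D = a" "ecb D = b" and ab: "a < 0" "0 < a + b"
    and nv: "\<And>s. s \<in> {0<..1} \<Longrightarrow> \<not> tile_vertex (z + s *\<^sub>R D)"
  shows "finite {s \<in> {0<..1}. long_edge (z + s *\<^sub>R D)}"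
    "card {s \<in> {0<..1}. long_edge (z + s *\<^sub>R D)} = nat (2 * b)"
proof -
  define S where "S = {s \<in> {0<..1}. - eca z + s * real_of_int (- a) \<in> \<int>}"
  define T where "T = {s \<in> {0<..1}. ecb z + s * real_of_int b \<in> \<int>}"
  define U where "U = {s \<in> {0<..1}. (eca z + ecb z) + s * real_of_int (a + b) \<in> \<int>}"
  have fin: "finite S" "finite T" "finite U"
    unfolding S_def T_def U_def using ab by (intro line_hits_integers(1); simp)+
  have card: "card S = nat (- a)" "card T = nat b" "card U = nat (a + b)"
    unfolding S_def T_def U_def using ab by (intro line_hits_integers(2); simp)+
  have S: "S = {s \<in> {0<..1}. eca (z + s *\<^sub>R D) \<in> \<int>}"
  proof -
    have "- eca z + s * real_of_int (- a) = - eca (z + s *\<^sub>R D)" for s by (simp add: D)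
    then show ?thesis unfolding S_def by (simp only: Ints_minus_iff)
  qed
  have T: "T = {s \<in> {0<..1}. ecb (z + s *\<^sub>R D) \<in> \<int>}" by (simp add: T_def D)
  have U: "U = {s \<in> {0<..1}. eca (z + s *\<^sub>R D) + ecb (z + s *\<^sub>R D) \<in> \<int>}"
    by (simp add: U_def D algebra_simps)
  have v: "tile_vertex w" if "eca w \<in> \<int> \<and> ecb w \<in> \<int> \<or> eca w \<in> \<int> \<and> eca w + ecb w \<in> \<int>
      \<or> ecb w \<in> \<int> \<and> eca w + ecb w \<in> \<int>" for w
  proof -
    have "eca w \<in> \<int> \<and> ecb w \<in> \<int>"
      using that Ints_diff[of "eca w + ecb w" "eca w"] Ints_diff[of "eca w + ecb w" "ecb w"]
      unfolding add_diff_cancel_left' add_diff_cancel by blast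
    then show ?thesis unfolding tile_vertex_def by (blast intro: Ints_diff Ints_mult Ints_numeral)
  qed
  have disj: "S \<inter> T = {}" "S \<inter> U = {}" "T \<inter> U = {}"
    unfolding S T U using v nv by blast+
  have eq: "{s \<in> {0<..1}. long_edge (z + s *\<^sub>R D)} = S \<union> T \<union> U"
    unfolding S T U long_edge_def by blast
  show "finite {s \<in> {0<..1}. long_edge (z + s *\<^sub>R D)}"
    unfolding eq by (rule card_disjoint_union3[OF fin disj])
  show "card {s \<in> {0<..1}. long_edge (z + s *\<^sub>R D)} = nat (2 * b)"
    unfolding eq card_disjoint_union3(2)[OF fin disj] card using ab by simp
qed

text \<open>Each of the three families of altitudes is described by a pair of coordinates that generates
the dual lattice, so \<open>line_hits_near_integers\<close> applies. The offset \<open>\<kappa>\<close> of the line is the same for all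
of them up to its sign, because it is the determinant of the position and the direction. That
the line avoids the centres makes \<open>X/3 \<plusminus> \<kappa>\<close> non-integral.\<close>
lemma short_edge_hits:
  fixes a b :: int and z D :: complex
  assumes D: "eca D = a" "ecb D = b" and ab: "a < 0" "0 < 2 * a + b" and co: "coprime a b"
    and nv: "\<And>s. s \<in> {0<..1} \<Longrightarrow> \<not> tile_vertex (z + s *\<^sub>R D)"
  shows "finite {s \<in> {0<..1}. short_edge (z + s *\<^sub>R D)}"
    "\<bar>3 * int (card {s \<in> {0<..1}. short_edge (z + s *\<^sub>R D)}) - (2 * (2 * a + b) + 6 * b)\<bar> < 3"
proof -
  define \<kappa> where "\<kappa> = b * eca z - a * ecb z"
  define S where "S = {s \<in> {0<..1}. (2 * eca z + ecb z) + s * real_of_int (2 * a + b) \<in> \<int>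
      \<and> near_int (eca z + s * real_of_int a)}"
  define T where "T = {s \<in> {0<..1}. (ecb z - eca z) + s * real_of_int (b - a) \<in> \<int>
      \<and> near_int (eca z + s * real_of_int a)}"
  define U where "U = {s \<in> {0<..1}. (eca z + 2 * ecb z) + s * real_of_int (a + 2 * b) \<in> \<int>
      \<and> near_int (ecb z + s * real_of_int b)}"
  have co1: "coprime (2 * a + b) a" using co by (metis add.commute coprime_commute coprime_iff_gcd_eq_1 gcd_add_mult)
  have co2: "coprime (b - a) a" using co by (metis coprime_commute coprime_iff_gcd_eq_1 gcd_diff1)
  have co3: "coprime (a + 2 * b) b" using co by (metis coprime_commute coprime_iff_gcd_eq_1 gcd_add_mult add.commute)
  have pos: "0 < 2 * a + b" "0 < b - a" "0 < a + 2 * b" using ab by auto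
  have K: "real_of_int (2 * a + b) * eca z - real_of_int a * (2 * eca z + ecb z) = \<kappa>"
    "real_of_int (b - a) * eca z - real_of_int a * (ecb z - eca z) = \<kappa>"
    "real_of_int (a + 2 * b) * ecb z - real_of_int b * (eca z + 2 * ecb z) = - \<kappa>"
    by (simp_all add: \<kappa>_def algebra_simps)
  note hits1 = line_hits_near_integers[OF pos(1) co1, where f = "2 * eca z + ecb z" and g = "eca z", unfolded K, folded S_def]
  note hits2 = line_hits_near_integers[OF pos(2) co2, where f = "ecb z - eca z" and g = "eca z", unfolded K, folded T_def]
  note hits3 = line_hits_near_integers[OF pos(3) co3, where f = "eca z + 2 * ecb z" and g = "ecb z", unfolded K, folded U_def]
  have S: "S = {s \<in> {0<..1}. 2 * eca (z + s *\<^sub>R D) + ecb (z + s *\<^sub>R D) \<in> \<int> \<and> near_int (eca (z + s *\<^sub>R D))}"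
    by (simp add: S_def D algebra_simps)
  have T: "T = {s \<in> {0<..1}. ecb (z + s *\<^sub>R D) - eca (z + s *\<^sub>R D) \<in> \<int> \<and> near_int (eca (z + s *\<^sub>R D))}"
    by (simp add: T_def D algebra_simps)
  have U: "U = {s \<in> {0<..1}. eca (z + s *\<^sub>R D) + 2 * ecb (z + s *\<^sub>R D) \<in> \<int> \<and> near_int (ecb (z + s *\<^sub>R D))}"
    by (simp add: U_def D algebra_simps)
  have v: "tile_vertex w" if "2 * eca w + ecb w \<in> \<int> \<and> ecb w - eca w \<in> \<int>
      \<or> 2 * eca w + ecb w \<in> \<int> \<and> eca w + 2 * ecb w \<in> \<int>
      \<or> ecb w - eca w \<in> \<int> \<and> eca w + 2 * ecb w \<in> \<int>" for w
    using that
  proof (elim disjE conjE)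
    assume i: "2 * eca w + ecb w \<in> \<int>" "ecb w - eca w \<in> \<int>"
    from Ints_combination[OF i, of "3 * eca w" 1 "-1"] i(2) show ?thesis by (simp add: tile_vertex_def)
  next
    assume i: "2 * eca w + ecb w \<in> \<int>" "eca w + 2 * ecb w \<in> \<int>"
    from Ints_combination[OF i, of "3 * eca w" 2 "-1"] Ints_combination[OF i, of "ecb w - eca w" "-1" 1]
    show ?thesis by (simp add: tile_vertex_def)
  next
    assume i: "ecb w - eca w \<in> \<int>" "eca w + 2 * ecb w \<in> \<int>"
    from Ints_combination[OF i, of "3 * eca w" "-2" 1] i(1) show ?thesis by (simp add: tile_vertex_def)
  qed
  have disj: "S \<inter> T = {}" "S \<inter> U = {}" "T \<inter> U = {}"
    unfolding S T U using v nv by blast+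
  have eq: "{s \<in> {0<..1}. short_edge (z + s *\<^sub>R D)} = S \<union> T \<union> U"
    unfolding S T U short_edge_def by blast
  note fin = hits1(1) hits2(1) hits3(1)
  show "finite {s \<in> {0<..1}. short_edge (z + s *\<^sub>R D)}"
    unfolding eq by (rule card_disjoint_union3[OF fin disj])
  \<comment> \<open>Equality would put a hit at distance exactly \<open>1/3\<close> from a lattice point, that is at a centre.\<close>
  have avoid: "\<bar>\<kappa> + j\<bar> \<noteq> (2 * a + b) / 3" for j :: int
  proof
    assume j: "\<bar>\<kappa> + j\<bar> = (2 * a + b) / 3"
    then obtain s k l where s: "s \<in> {0<..1}" and k: "(2 * eca z + ecb z) + s * real_of_int (2 * a + b) = of_int k"
      and l: "eca z + s * real_of_int a = of_int l + (\<kappa> + j) / (2 * a + b)"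
      using hits1(3)[of j] by auto
    define w where "w = z + s *\<^sub>R D"
    have "(\<kappa> + j) / (2 * a + b) = 1/3 \<or> (\<kappa> + j) / (2 * a + b) = - (1/3)"
      using j ab(2) by (auto simp: abs_if field_simps split: if_splits)
    then have "eca w = of_int l + 1/3 \<or> eca w = of_int l - 1/3"
      using l unfolding w_def D eca_simps by argo
    then have "3 * eca w = of_int (3 * l + 1) \<or> 3 * eca w = of_int (3 * l - 1)"
      by (elim disjE) simp_all
    then have 1: "3 * eca w \<in> \<int>" by (metis Ints_of_int)
    have "2 * eca w + ecb w = of_int k" using k by (simp add: w_def D algebra_simps)
    then have 2: "2 * eca w + ecb w \<in> \<int>" by simp
    have "ecb w - eca w \<in> \<int>" using Ints_combination[OF 1 2, of "ecb w - eca w" "-1" 1] by simp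
    with 1 have "tile_vertex w" by (simp add: tile_vertex_def)
    with nv[OF s] show False by (simp add: w_def)
  qed
  have "(2 * a + b) / 3 - \<kappa> \<notin> \<int>"
  proof
    assume "(2 * a + b) / 3 - \<kappa> \<in> \<int>"
    then obtain j :: int where "(2 * a + b) / 3 - \<kappa> = j" by (auto elim: Ints_cases)
    then have "\<kappa> + j = (2 * a + b) / 3" by linarith
    moreover have "0 < (2 * a + b) / (3::real)" using ab(2) by simp
    ultimately have "\<bar>\<kappa> + j\<bar> = (2 * a + b) / 3" by linarith
    with avoid show False by blast
  qed
  moreover have "(2 * a + b) / 3 + \<kappa> \<notin> \<int>"
  proof
    assume "(2 * a + b) / 3 + \<kappa> \<in> \<int>"
    then obtain j :: int where "(2 * a + b) / 3 + \<kappa> = j" by (auto elim: Ints_cases)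
    then have "\<kappa> + of_int (- j) = - ((2 * a + b) / 3)" by (simp add: algebra_simps)
    moreover have "0 < (2 * a + b) / (3::real)" using ab(2) by simp
    ultimately have "\<bar>\<kappa> + of_int (- j)\<bar> = (2 * a + b) / 3" by linarith
    with avoid show False by blast
  qed
  ultimately have "\<bar>3 * ((\<lfloor>(2 * a + b) / 3 - \<kappa>\<rfloor> + \<lfloor>(2 * a + b) / 3 + \<kappa>\<rfloor> + 1)
      + (\<lfloor>(b - a) / 3 - \<kappa>\<rfloor> + \<lfloor>(b - a) / 3 + \<kappa>\<rfloor> + 1)
      + (\<lfloor>(a + 2 * b) / 3 - \<kappa>\<rfloor> + \<lfloor>(a + 2 * b) / 3 + \<kappa>\<rfloor> + 1)) - (2 * (2 * a + b) + 6 * b)\<bar> < 3"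
    by (rule three_family_floor_sum[OF refl])
  then show "\<bar>3 * int (card {s \<in> {0<..1}. short_edge (z + s *\<^sub>R D)}) - (2 * (2 * a + b) + 6 * b)\<bar> < 3"
    unfolding eq card_disjoint_union3(2)[OF fin disj] of_nat_add hits1(2) hits2(2) hits3(2)
    by (simp add: add.commute)
qed

section \<open>The unfolded orbit\<close>
lemma Re_Im_coords: "Re z = eca z + ecb z / 2" "Im z = ecb z * sqrt 3 / 2"
  by (simp_all add: eca_def ecb_def field_simps)

lemma omega_coords: "eca \<omega> = 0" "ecb \<omega> = 1"
  using eca_simps(8)[of 1] ecb_simps(8)[of 1] by simp_all

lemma cnj_omega_power3: "cnj \<omega> ^ 3 = -1"
  using arg_cong[OF omega_power3, of cnj] by simp

lemma finite_card_shift: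
  fixes P :: "real \<Rightarrow> bool"
  assumes per: "\<And>s. P (s + 1) \<longleftrightarrow> P s" and fin: "finite {s \<in> {0<..1}. P s}" "finite {s \<in> {0<..r}. P s}" and r: "0 \<le> r"
  shows "card {s \<in> {0<..r + 1}. P s} = card {s \<in> {0<..1}. P s} + card {s \<in> {0<..r}. P s}"
proof -
  have "{s \<in> {0<..r + 1}. P s} = {s \<in> {0<..1}. P s} \<union> (\<lambda>s. s + 1) ` {s \<in> {0<..r}. P s}"
  proof (intro set_eqI iffI)
    fix s assume s: "s \<in> {s \<in> {0<..r + 1}. P s}"
    show "s \<in> {s \<in> {0<..1}. P s} \<union> (\<lambda>s. s + 1) ` {s \<in> {0<..r}. P s}"
    proof (cases "s \<le> 1")
      case False
      then have "s - 1 \<in> {s \<in> {0<..r}. P s}" using s per[of "s - 1"] by simp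
      then show ?thesis by (intro UnI2 image_eqI[of _ _ "s - 1"]) auto
    qed (use s in auto)
  qed (use r in \<open>auto simp: per\<close>)
  moreover have "{s \<in> {0<..1}. P s} \<inter> (\<lambda>s. s + 1) ` {s \<in> {0<..r}. P s} = {}" by auto
  ultimately show ?thesis using fin by (simp add: card_Un_disjoint card_image)
qed

text \<open>An orbit in the normalised triangle. Time is scaled so that the initial velocity is the primitive
lattice vector itself: the unfolded orbit then advances by one lattice period per unit of time. The
conditions on \<open>a\<close> and \<open>b\<close> express that the initial angle lies between \<open>60\<close> and \<open>90\<close> degrees.\<close>
locale base_billiard =
  fixes Q :: "real \<Rightarrow> complex" and t :: "nat \<Rightarrow> real" and V :: "nat \<Rightarrow> complex" and a b :: int
  assumes t_0: "t 0 = 0" and t_less: "t n < t (Suc n)" and t_lim: "filterlim t at_top sequentially"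
    and flight: "s \<in> {t n..t (Suc n)} \<Longrightarrow> Q s = Q (t n) + (s - t n) *\<^sub>R V n"
    and inside: "s \<in> {t n<..<t (Suc n)} \<Longrightarrow> Q s \<in> chamber"
    and bounce: "(Q (t (Suc n)) \<in> base_edge \<and> V (Suc n) = cnj (V n)) \<or>
      (Q (t (Suc n)) \<in> left_edge \<and> V (Suc n) = \<omega> * cnj (V n)) \<or>
      (Q (t (Suc n)) \<in> right_edge \<and> V (Suc n) = cnj \<omega> * cnj (V n))"
    and start: "Q 0 \<in> base_edge"
    and direction: "eca (V 0) = a" "ecb (V 0) = b"
    and cop: "coprime a b" and steep: "a < 0" "0 < 2 * a + b"
begin

definition unfolded :: "real \<Rightarrow> complex" where "unfolded s = Q 0 + s *\<^sub>R V 0"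

lemma unfolded_add: "unfolded (s + r) = unfolded s + r *\<^sub>R V 0"
  by (simp add: unfolded_def scaleR_left_distrib)

lemma direction_in_lattice: "V 0 \<in> lattice"
  by (simp add: lattice_def direction)

lemma t_mono: "strict_mono t"
  using t_less by (simp add: strict_mono_Suc_iff)

lemma flight_interval:
  assumes "0 \<le> s" obtains n where "t n \<le> s" "s < t (Suc n)"
proof -
  have ex: "\<exists>n. s < t n"
    using t_lim unfolding filterlim_at_top_dense eventually_sequentially by blast
  define N where "N = (LEAST n. s < t n)"
  have N: "s < t N" unfolding N_def using ex by (rule LeastI_ex)
  then have "N \<noteq> 0" using assms t_0 by (metis not_less)
  then obtain n where n: "N = Suc n" using not0_implies_Suc by blast
  then have "\<not> s < t n" unfolding N_def by (metis lessI not_less_Least)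
  then show ?thesis using that[of n] N n by simp
qed

lemma t_pos: "0 < t (Suc n)"
  using strict_monoD[OF t_mono, of 0 "Suc n"] t_0 by simp

lemma time_cases:
  assumes "0 < s"
  obtains (strike) n where "s = t (Suc n)" | (flying) n where "s \<in> {t n<..<t (Suc n)}"
proof -
  obtain n where n: "t n \<le> s" "s < t (Suc n)" using flight_interval[of s] assms by auto
  show ?thesis
  proof (cases "s = t n")
    case True
    then have "n \<noteq> 0" using assms t_0 by (metis less_irrefl)
    then show ?thesis using True that(1) by (metis not0_implies_Suc)
  next
    case False
    then show ?thesis using n that(2)[of n] by simp
  qed
qed

lemma bounce_reflection:
  obtains g l where "g \<in> dihedral" "l \<in> lattice" "V (Suc n) = g (V n)"
    "Q (t (Suc n)) = g (Q (t (Suc n))) + l"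
proof -
  let ?z = "Q (t (Suc n))"
  consider "?z \<in> base_edge" "V (Suc n) = cnj (V n)" | "?z \<in> left_edge" "V (Suc n) = \<omega> * cnj (V n)"
    | "?z \<in> right_edge" "V (Suc n) = cnj \<omega> * cnj (V n)"
    using bounce[of n] by blast
  then show ?thesis
  proof cases
    case 1
    have "cnj \<in> dihedral" unfolding dihedral_def by (auto intro!: exI[of _ 0])
    moreover have "?z = cnj ?z + 0" using 1 by (intro coords_eqI) (simp_all add: base_edge_def)
    ultimately show ?thesis using 1 lattice_closed(1) that by blast
  next
    case 2
    have "(\<lambda>z. \<omega> * cnj z) \<in> dihedral" unfolding dihedral_def by (auto intro!: exI[of _ 1])
    moreover have "?z = \<omega> * cnj ?z + 0" using 2 by (intro coords_eqI) (simp_all add: left_edge_def)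
    ultimately show ?thesis using 2 lattice_closed(1) that by blast
  next
    case 3
    have "(\<lambda>z. cnj \<omega> * cnj z) \<in> dihedral"
      unfolding dihedral_def cnj_omega by blast
    moreover have "?z = cnj \<omega> * cnj ?z + \<omega>" using 3 unfolding cnj_omega
      by (intro coords_eqI) (simp_all add: right_edge_def omega_coords numeral_eq_Suc mult.assoc)
    moreover have "\<omega> \<in> lattice" by (simp add: lattice_def omega_coords)
    ultimately show ?thesis using 3 that by blast
  qed
qed

text \<open>At each bounce the isometry is composed with the reflection in the edge that is struck. This
reflection is again a symmetry of the lattice, and it fixes the point of impact, so that the motion after
the bounce is the image of the same straight line.\<close>
lemma unfolding_isometry:
  obtains h l where "h \<in> dihedral" "l \<in> lattice" "V n = h (V 0)"
    "\<And>s. s \<in> {t n..t (Suc n)} \<Longrightarrow> Q s = h (unfolded s) + l"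
proof -
  have "\<exists>h\<in>dihedral. \<exists>l\<in>lattice. V n = h (V 0) \<and> (\<forall>s\<in>{t n..t (Suc n)}. Q s = h (unfolded s) + l)"
  proof (induction n)
    case 0
    have "Q s = unfolded s + 0" if "s \<in> {t 0..t (Suc 0)}" for s
      using flight[OF that] unfolding unfolded_def t_0 by simp
    then show ?case
      by (intro bexI[of _ "\<lambda>z. z"] bexI[of _ 0] conjI ballI dihedral_id lattice_closed(1)) blast+
  next
    case (Suc n)
    then obtain h l where h: "h \<in> dihedral" and l: "l \<in> lattice" and v: "V n = h (V 0)"
      and q: "\<And>s. s \<in> {t n..t (Suc n)} \<Longrightarrow> Q s = h (unfolded s) + l" by blast
    obtain g l' where g: "g \<in> dihedral" and l': "l' \<in> lattice" and v': "V (Suc n) = g (V n)"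
      and fix_point: "Q (t (Suc n)) = g (Q (t (Suc n))) + l'" by (rule bounce_reflection)
    have "Q s = g (h (unfolded s)) + (g l + l')" if s: "s \<in> {t (Suc n)..t (Suc (Suc n))}" for s
    proof -
      let ?r = "s - t (Suc n)"
      have "Q s = Q (t (Suc n)) + ?r *\<^sub>R g (V n)" using flight[OF s] v' by simp
      also have "\<dots> = g (Q (t (Suc n)) + ?r *\<^sub>R V n) + l'"
        by (subst fix_point) (simp add: dihedral_add[OF g] dihedral_scaleR[OF g])
      also have "Q (t (Suc n)) + ?r *\<^sub>R V n = h (unfolded (t (Suc n))) + l + ?r *\<^sub>R h (V 0)"
        using q[of "t (Suc n)"] t_less[of n] v by simp
      also have "\<dots> = h (unfolded (t (Suc n)) + ?r *\<^sub>R V 0) + l"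
        by (simp add: dihedral_add[OF h] dihedral_scaleR[OF h])
      also have "unfolded (t (Suc n)) + ?r *\<^sub>R V 0 = unfolded s" by (simp flip: unfolded_add)
      finally show ?thesis by (simp add: dihedral_add[OF g])
    qed
    moreover have "g l + l' \<in> lattice" using g l l' by (simp add: lattice_closed dihedral_lattice)
    moreover have "V (Suc n) = g (h (V 0))" using v v' by simp
    ultimately show ?case using dihedral_comp[OF g h]
      by (intro bexI[of _ "\<lambda>z. g (h z)"] bexI[of _ "g l + l'"]) auto
  qed
  then show ?thesis using that by blast
qed

lemma tiling_along_orbit:
  assumes "s \<in> {t n..t (Suc n)}"
  shows "long_edge (unfolded s) \<longleftrightarrow> long_edge (Q s)" "short_edge (unfolded s) \<longleftrightarrow> short_edge (Q s)"
    "tile_vertex (unfolded s) \<longleftrightarrow> tile_vertex (Q s)"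
proof -
  obtain h l where "h \<in> dihedral" "l \<in> lattice" "Q s = h (unfolded s) + l"
    using unfolding_isometry[of n] assms by metis
  then show "long_edge (unfolded s) \<longleftrightarrow> long_edge (Q s)" "short_edge (unfolded s) \<longleftrightarrow> short_edge (Q s)"
    "tile_vertex (unfolded s) \<longleftrightarrow> tile_vertex (Q s)"
    by (simp_all add: tiling_invariant)
qed

lemma strike_edge:
  "(long_edge (unfolded (t (Suc n))) \<and> \<not> short_edge (unfolded (t (Suc n))) \<and> V (Suc n) = cnj (V n)) \<or>
   (short_edge (unfolded (t (Suc n))) \<and> (V (Suc n) = \<omega> * cnj (V n) \<or> V (Suc n) = cnj \<omega> * cnj (V n)))"
  "\<not> tile_vertex (unfolded (t (Suc n)))"
proof -
  have s: "t (Suc n) \<in> {t n..t (Suc n)}" using t_less[of n] by simp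
  note tiling = tiling_along_orbit[OF s]
  let ?z = "Q (t (Suc n))"
  have base: "long_edge ?z \<and> \<not> short_edge ?z \<and> \<not> tile_vertex ?z" if "?z \<in> base_edge"
    using base_edge_tiling[OF that] long_short_edge_vertex[of ?z] by blast
  have side: "short_edge ?z \<and> \<not> tile_vertex ?z" if "?z \<in> left_edge \<or> ?z \<in> right_edge"
    using side_edge_tiling[of ?z] that by blast
  show "(long_edge (unfolded (t (Suc n))) \<and> \<not> short_edge (unfolded (t (Suc n))) \<and> V (Suc n) = cnj (V n)) \<or>
   (short_edge (unfolded (t (Suc n))) \<and> (V (Suc n) = \<omega> * cnj (V n) \<or> V (Suc n) = cnj \<omega> * cnj (V n)))"
    unfolding tiling using bounce[of n] base side by argo
  show "\<not> tile_vertex (unfolded (t (Suc n)))"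
    unfolding tiling using bounce[of n] base side by argo
qed

lemma flying_no_edge:
  assumes "s \<in> {t n<..<t (Suc n)}"
  shows "\<not> long_edge (unfolded s)" "\<not> short_edge (unfolded s)" "\<not> tile_vertex (unfolded s)"
  using chamber_no_edge[OF inside[OF assms]] tiling_along_orbit[of s n] assms by simp_all

lemma strike_iff_edge:
  assumes "0 < s"
  shows "(\<exists>n. s = t (Suc n)) \<longleftrightarrow> long_edge (unfolded s) \<or> short_edge (unfolded s)"
proof -
  have "t (Suc n) \<notin> {t m<..<t (Suc m)}" for m n
    using strict_mono_less[OF t_mono] by auto
  with assms show ?thesis
  proof (cases rule: time_cases)
    case (strike n)
    then show ?thesis using strike_edge(1)[of n] by auto
  next
    case (flying n)
    then show ?thesis using flying_no_edge[OF flying] \<open>\<And>m n. t (Suc n) \<notin> {t m<..<t (Suc m)}\<close> by auto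
  qed
qed

lemma no_vertex: "0 < s \<Longrightarrow> \<not> tile_vertex (unfolded s)"
  by (cases rule: time_cases[of s]) (simp_all add: strike_edge(2) flying_no_edge(3))

lemma edges_periodic: "long_edge (unfolded (s + 1)) \<longleftrightarrow> long_edge (unfolded s)" "short_edge (unfolded (s + 1)) \<longleftrightarrow> short_edge (unfolded s)"
  by (simp_all add: unfolded_add lattice_translate direction_in_lattice)

definition side_hits :: nat where "side_hits = card {s \<in> {0<..1}. short_edge (unfolded s)}"

lemma count_edges:
  "finite {s \<in> {0<..1}. long_edge (unfolded s)}" "card {s \<in> {0<..1}. long_edge (unfolded s)} = nat (2 * b)"
  "finite {s \<in> {0<..1}. short_edge (unfolded s)}" "\<bar>3 * int side_hits - (2 * (2 * a + b) + 6 * b)\<bar> < 3"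
proof -
  have nv: "\<And>s. s \<in> {0<..1} \<Longrightarrow> \<not> tile_vertex (Q 0 + s *\<^sub>R V 0)"
    using no_vertex by (simp add: unfolded_def)
  have ab: "0 < a + b" using steep by linarith
  show "finite {s \<in> {0<..1}. long_edge (unfolded s)}" "card {s \<in> {0<..1}. long_edge (unfolded s)} = nat (2 * b)"
    "finite {s \<in> {0<..1}. short_edge (unfolded s)}" "\<bar>3 * int side_hits - (2 * (2 * a + b) + 6 * b)\<bar> < 3"
    unfolding unfolded_def side_hits_def using long_edge_hits[OF direction steep(1) ab nv]
      short_edge_hits[OF direction steep cop nv] by simp_all
qed

definition strikes :: "real \<Rightarrow> real set" where
  "strikes r = {s \<in> {0<..r}. \<exists>n. s = t (Suc n)}"

lemma card_strikes: "card (strikes 1) = nat (2 * b) + side_hits" "card (strikes 2) = 2 * (nat (2 * b) + side_hits)"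
proof -
  have eq: "strikes r = {s \<in> {0<..r}. long_edge (unfolded s) \<or> short_edge (unfolded s)}" for r
    unfolding strikes_def using strike_iff_edge by auto
  have u: "strikes 1 = {s \<in> {0<..1}. long_edge (unfolded s)} \<union> {s \<in> {0<..1}. short_edge (unfolded s)}"
    unfolding eq by blast
  have d: "{s \<in> {0<..1}. long_edge (unfolded s)} \<inter> {s \<in> {0<..1}. short_edge (unfolded s)} = {}"
    using no_vertex long_short_edge_vertex by fastforce
  show one: "card (strikes 1) = nat (2 * b) + side_hits"
    unfolding u card_Un_disjoint[OF count_edges(1,3) d] count_edges(2) side_hits_def ..
  have "finite (strikes 1)" unfolding u using count_edges by simp
  then have "card (strikes (1 + 1)) = card (strikes 1) + card (strikes 1)"
    unfolding eq by (intro finite_card_shift) (auto simp: edges_periodic)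
  then show "card (strikes 2) = 2 * (nat (2 * b) + side_hits)" using one by simp
qed

text \<open>The direction is not parallel to a mirror of the dihedral group: these are exactly the directions
whose cube is real or purely imaginary.\<close>
lemma cube_direction: "Re (V 0 ^ 3) \<noteq> 0" "Im (V 0 ^ 3) \<noteq> 0"
proof -
  define x y where "x = real_of_int (2 * a + b)" and "y = real_of_int b"
  have xy: "0 < x" "x < y" using steep by (simp_all add: x_def y_def)
  have D: "Re (V 0) = x / 2" "Im (V 0) = y * sqrt 3 / 2"
    by (simp_all add: Re_Im_coords direction x_def y_def field_simps)
  have sq: "x * x < y * y" using xy by (intro mult_strict_mono) auto
  have "Re (V 0 ^ 3) = x * (x * x - 9 * (y * y)) / 8"
    by (simp add: power3_eq_cube D algebra_simps)
  then show "Re (V 0 ^ 3) \<noteq> 0" using xy sq by auto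
  have "Im (V 0 ^ 3) = 3 * sqrt 3 * y * (x * x - y * y) / 8"
    by (simp add: power3_eq_cube D algebra_simps)
  then show "Im (V 0 ^ 3) \<noteq> 0" using xy sq by auto
qed

text \<open>A bounce off the base replaces \<open>V\<^sup>3\<close> by its conjugate, a bounce off one of the equal sides replaces it by
minus the conjugate, because \<open>\<omega>\<^sup>3 = -1\<close>. So the sign of the real part of the cube keeps track of
the parity of the number of bounces off the equal sides.\<close>
lemma side_bounce_parity:
  assumes "t n \<le> s" "s < t (Suc n)"
  shows "finite {r \<in> {0<..s}. short_edge (unfolded r)}"
    "Re (V n ^ 3) = (-1) ^ card {r \<in> {0<..s}. short_edge (unfolded r)} * Re (V 0 ^ 3)"
proof -
  define A where "A s = {r \<in> {0<..s}. short_edge (unfolded r)}" for s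
  have extend: "A s = A (t n)" if "t n \<le> s" "s < t (Suc n)" for s n
  proof -
    have "r \<le> t n" if "r \<in> A s" for r
      using that flying_no_edge(2)[of r n] \<open>s < t (Suc n)\<close> by (force simp: A_def)
    then show ?thesis using \<open>t n \<le> s\<close> by (auto simp: A_def)
  qed
  have step: "A (t (Suc n)) = A (t n) \<union> (if short_edge (unfolded (t (Suc n))) then {t (Suc n)} else {})" for n
  proof -
    have "r \<le> t n \<or> r = t (Suc n)" if "r \<in> A (t (Suc n))" for r
      using that flying_no_edge(2)[of r n] by (force simp: A_def)
    then show ?thesis using t_less[of n] t_pos[of n] by (auto simp: A_def)
  qed
  have "finite (A (t n)) \<and> Re (V n ^ 3) = (-1) ^ card (A (t n)) * Re (V 0 ^ 3)" for n
  proof (induction n)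
    case 0
    then show ?case by (simp add: A_def t_0)
  next
    case (Suc n)
    have new: "t (Suc n) \<notin> A (t n)" using t_less[of n] by (auto simp: A_def)
    show ?case
    proof (cases "short_edge (unfolded (t (Suc n)))")
      case True
      then have "V (Suc n) ^ 3 = - (cnj (V n ^ 3))"
        using strike_edge(1)[of n] by (auto simp: power_mult_distrib omega_power3 cnj_omega_power3)
      then have "Re (V (Suc n) ^ 3) = - Re (V n ^ 3)" by (simp del: complex_cnj_power)
      then show ?thesis using Suc new True by (simp add: step)
    next
      case False
      then have "V (Suc n) ^ 3 = cnj (V n ^ 3)" using strike_edge(1)[of n] by auto
      then have "Re (V (Suc n) ^ 3) = Re (V n ^ 3)" by (simp del: complex_cnj_power)
      then show ?thesis using Suc new False by (simp add: step)
    qed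
  qed
  from this[of n] extend[OF assms]
  show "finite {r \<in> {0<..s}. short_edge (unfolded r)}"
    "Re (V n ^ 3) = (-1) ^ card {r \<in> {0<..s}. short_edge (unfolded r)} * Re (V 0 ^ 3)"
    by (simp_all add: A_def)
qed

text \<open>The unfolded orbit has advanced by a lattice vector, so the old and the new position differ by a
lattice symmetry, which must be a symmetry of the triangle. The reflection in the axis changes the sign of
the real part of the cubed velocity, the identity does not.\<close>
lemma position_after_unit_time:
  assumes s: "0 \<le> s"
  shows "Q (s + 1) = (if even side_hits then Q s else 1 - cnj (Q s))"
proof -
  obtain n where n: "t n \<le> s" "s < t (Suc n)" using flight_interval[OF s] .
  obtain m where m: "t m \<le> s + 1" "s + 1 < t (Suc m)" using flight_interval[of "s + 1"] s by auto
  obtain h l where h: "h \<in> dihedral" and l: "l \<in> lattice" and v: "V n = h (V 0)"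
    and q: "\<And>s. s \<in> {t n..t (Suc n)} \<Longrightarrow> Q s = h (unfolded s) + l" by (rule unfolding_isometry[of n]) blast
  obtain h' l' where h': "h' \<in> dihedral" and l': "l' \<in> lattice" and v': "V m = h' (V 0)"
    and q': "\<And>s. s \<in> {t m..t (Suc m)} \<Longrightarrow> Q s = h' (unfolded s) + l'" by (rule unfolding_isometry[of m]) blast
  obtain g where g: "g \<in> dihedral" and inv: "\<And>z. g (h z) = z" using dihedral_inverse[OF h] by blast
  define k where "k = (\<lambda>z. h' (g z))"
  have k: "k \<in> dihedral" unfolding k_def by (rule dihedral_comp[OF h' g])
  have kh: "k (h z) = h' z" for z by (simp add: k_def inv)
  define \<mu> where "\<mu> = h' (V 0) + l' + - k l"
  have \<mu>: "\<mu> \<in> lattice" unfolding \<mu>_def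
    using dihedral_lattice[OF h' direction_in_lattice] dihedral_lattice[OF k l] l'
    by (intro lattice_closed(2,3))
  have Vm: "V m = k (V n)" by (simp add: v v' kh)
  have move: "Q (r + 1) = k (Q r) + \<mu>" if "r \<in> {t n..t (Suc n)}" "r + 1 \<in> {t m..t (Suc m)}" for r
    using q[OF that(1)] q'[OF that(2)]
    by (simp add: unfolded_add \<mu>_def dihedral_add[OF k] dihedral_add[OF h'] kh)
  \<comment> \<open>At time \<open>s\<close> the particle may be on the boundary. The isometry is therefore identified at a slightly later
    time at which both positions are interior.\<close>
  define r where "r = s + min (t (Suc n) - s) (t (Suc m) - s - 1) / 2"
  have r: "r \<in> {t n<..<t (Suc n)}" "r + 1 \<in> {t m<..<t (Suc m)}"
    using n m by (auto simp: r_def min_def field_simps)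
  have "k (Q r) + \<mu> \<in> chamber" using inside[OF r(2)] move[of r] r by simp
  then have stab: "(k = (\<lambda>z. z) \<and> \<mu> = 0) \<or> (k = (\<lambda>z. - cnj z) \<and> \<mu> = 1)"
    using chamber_stabilizer[OF k \<mu> inside[OF r(1)]] by blast
  have Qs: "Q (s + 1) = k (Q s) + \<mu>" using move[of s] n m by simp
  have "card {r \<in> {0<..s + 1}. short_edge (unfolded r)} = side_hits + card {r \<in> {0<..s}. short_edge (unfolded r)}"
    unfolding side_hits_def using s count_edges(3) side_bounce_parity(1)[OF n]
    by (intro finite_card_shift edges_periodic)
  then have parity: "Re (V m ^ 3) = (-1) ^ side_hits * Re (V n ^ 3)"
    using side_bounce_parity(2)[OF n] side_bounce_parity(2)[OF m] by (simp add: power_add)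
  have "Re (V n ^ 3) \<noteq> 0" using side_bounce_parity(2)[OF n] cube_direction(1) by simp
  moreover have "Re (V m ^ 3) = - Re (V n ^ 3)" if "k = (\<lambda>z. - cnj z)"
  proof -
    have "V m ^ 3 = - cnj (V n ^ 3)" by (simp add: Vm that power3_eq_cube)
    then show ?thesis by (simp del: complex_cnj_power)
  qed
  ultimately show ?thesis using stab parity Qs Vm by auto
qed

text \<open>When the orbit retraces itself, the velocity has returned to its initial value too. It determines
the linear part of the unfolding isometry, which is then the identity. The displacement of
the unfolded orbit is a lattice vector, and since \<open>a\<close> and \<open>b\<close> are coprime it is an integral multiple
of \<open>V 0\<close>.\<close>
lemma retraces_after_integer:
  assumes "retraces_after Q r" and m: "t m \<le> r" "r < t (Suc m)"
  shows "r \<in> \<int>" "V m = V 0"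
proof -
  have r: "0 < r" and ret: "\<And>s. 0 \<le> s \<Longrightarrow> Q (s + r) = Q s" using assms by (auto simp: retraces_after_def)
  define e where "e = min (t 1) (t (Suc m) - r) / 2"
  have e: "0 < e" "e < t 1" "r + e < t (Suc m)" using m t_pos[of 0] by (auto simp: e_def min_def field_simps)
  have "Q e = Q 0 + e *\<^sub>R V 0" using flight[of e 0] e t_0 by simp
  moreover have "Q (e + r) = Q r + e *\<^sub>R V m"
  proof -
    have "Q (e + r) = Q (t m) + ((r - t m) + e) *\<^sub>R V m"
      using flight[of "e + r" m] e m by (simp add: algebra_simps)
    moreover have "Q r = Q (t m) + (r - t m) *\<^sub>R V m" using flight[of r m] m by simp
    ultimately show ?thesis by (simp only: scaleR_left_distrib add.assoc)
  qed
  ultimately have "e *\<^sub>R V m = e *\<^sub>R V 0" using ret[of e] ret[of 0] e by simp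
  then show Vm: "V m = V 0" using e by simp
  obtain h l where h: "h \<in> dihedral" and l: "l \<in> lattice" and v: "V m = h (V 0)"
    and q: "\<And>s. s \<in> {t m..t (Suc m)} \<Longrightarrow> Q s = h (unfolded s) + l" by (rule unfolding_isometry[of m]) blast
  obtain k where k: "h = (\<lambda>z. \<omega> ^ k * z) \<or> h = (\<lambda>z. \<omega> ^ k * cnj z)"
    using h by (auto simp: dihedral_def)
  have V0: "V 0 \<noteq> 0" using cube_direction by auto
  have "h \<noteq> (\<lambda>z. \<omega> ^ k * cnj z)"
  proof
    assume "h = (\<lambda>z. \<omega> ^ k * cnj z)"
    then have "V 0 = \<omega> ^ k * cnj (V 0)" using Vm v by simp
    then have "V 0 ^ 3 = (-1) ^ k * cnj (V 0 ^ 3)"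
      by (metis complex_cnj_power omega_power3 power_commutes power_mult power_mult_distrib mult.commute)
    then have "V 0 ^ 3 = cnj (V 0 ^ 3) \<or> V 0 ^ 3 = - cnj (V 0 ^ 3)"
      by (cases "even k") simp_all
    then have "Im (V 0 ^ 3) = 0 \<or> Re (V 0 ^ 3) = 0"
      by (metis add.inverse_inverse complex_cnj cnj.sel equal_neg_zero uminus_complex.sel)
    then show False using cube_direction by blast
  qed
  then have "h = (\<lambda>z. \<omega> ^ k * z)" using k by blast
  then have "h = (\<lambda>z. z)" using Vm v V0 by auto
  then have "Q r = unfolded r + l" using q[of r] m by simp
  moreover have "Q r = Q 0" using ret[of 0] by simp
  ultimately have "r *\<^sub>R V 0 = - l" by (simp add: unfolded_def add_eq_0_iff2)
  then have "r *\<^sub>R V 0 \<in> lattice" using l lattice_closed(3) by simp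
  then have i: "r * a \<in> \<int>" "r * b \<in> \<int>" by (simp_all add: lattice_def direction)
  obtain x y where "x * a + y * b = 1" using cop by (metis bezout_int coprime_iff_gcd_eq_1)
  then have "r = r * of_int (x * a + y * b)" by simp
  also have "\<dots> = of_int x * (r * a) + of_int y * (r * b)" by (simp add: algebra_simps)
  finally show "r \<in> \<int>" by (rule Ints_combination[OF i])
qed

definition period :: real where "period = (if even side_hits then 1 else 2)"

lemma retraces_after_period: "retraces_after Q period"
proof (cases "even side_hits")
  case True
  then show ?thesis by (simp add: retraces_after_def position_after_unit_time period_def)
next
  case False
  have "Q (s + 2) = Q s" if "0 \<le> s" for s
    using position_after_unit_time[of s] position_after_unit_time[of "s + 1"] that False
    by (simp add: add.assoc)
  then show ?thesis using False by (simp add: retraces_after_def period_def)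
qed

lemma period_le:
  assumes ret: "retraces_after Q r" shows "period \<le> r"
proof -
  have r: "0 < r" using ret by (simp add: retraces_after_def)
  obtain m where m: "t m \<le> r" "r < t (Suc m)" using flight_interval[of r] r by auto
  have "even side_hits" if "r = 1"
  proof (rule ccontr)
    assume "odd side_hits"
    then have "Re (V m ^ 3) = - Re (V 0 ^ 3)"
      using side_bounce_parity(2)[OF m] that by (simp add: side_hits_def)
    then show False using retraces_after_integer(2)[OF ret m] cube_direction(1) by simp
  qed
  moreover obtain j :: int where "r = j"
    using retraces_after_integer(1)[OF ret m] by (auto elim: Ints_cases)
  moreover have "j = 1 \<or> 2 \<le> j" using r \<open>r = j\<close> by (simp, presburger)
  ultimately show ?thesis by (auto simp: period_def)
qed

lemma card_strikes_period:
  "card (strikes period) = (if even side_hits then nat (2 * b) + side_hits else 2 * (nat (2 * b) + side_hits))"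
  by (simp add: period_def card_strikes)

end

section \<open>The period formula\<close>

text \<open>The bound determines \<open>E\<close> up to two consecutive values, one of each parity, unless \<open>3\<close> divides \<open>x\<close>; in
that case \<open>E\<close> is determined, and it is even.\<close>
lemma period_arith:
  fixes x y e E p :: nat
  assumes e: "e = (if x mod 2 = y mod 2 then 1 else 2)"
    and E: "\<bar>3 * int E - (2 * int (e * x) + 6 * int (e * y))\<bar> < 3"
    and p: "p = (if even E then 2 * (e * y) + E else 2 * (2 * (e * y) + E))"
  shows "(x mod 3 = 0 \<and> x mod 2 = y mod 2 \<longrightarrow> real p = 4 * real y + 2 * real x / 3) \<and>
         (x mod 3 = 0 \<and> x mod 2 \<noteq> y mod 2 \<longrightarrow> real p = 8 * real y + 4 * real x / 3) \<and>
         (x mod 3 = 1 \<and> x mod 2 = y mod 2 \<longrightarrow>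
            real p = 4 * real y + (2 * real x - 2) / 3 \<or> real p = 8 * real y + (4 * real x + 2) / 3) \<and>
         (x mod 3 = 1 \<and> x mod 2 \<noteq> y mod 2 \<longrightarrow>
            real p = 16 * real y + (8 * real x - 2) / 3 \<or> real p = 8 * real y + (4 * real x + 2) / 3) \<and>
         (x mod 3 = 2 \<and> x mod 2 = y mod 2 \<longrightarrow>
            real p = 4 * real y + (2 * real x + 2) / 3 \<or> real p = 8 * real y + (4 * real x - 2) / 3) \<and>
         (x mod 3 = 2 \<and> x mod 2 \<noteq> y mod 2 \<longrightarrow>
            real p = 16 * real y + (8 * real x + 2) / 3 \<or> real p = 8 * real y + (4 * real x - 2) / 3)"
proof -
  obtain i j where x: "x = 3 * i + j" and j: "j = 0 \<or> j = 1 \<or> j = 2"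
  proof (rule that)
    show "x = 3 * (x div 3) + x mod 3" by simp
    show "x mod 3 = 0 \<or> x mod 3 = 1 \<or> x mod 3 = 2" by linarith
  qed
  have xj: "x mod 3 = j" using x j by auto
  show ?thesis
  proof (cases "x mod 2 = y mod 2")
    case True
    have e1: "e = 1" using e True by simp
    have bounds: "3 * E < 2 * x + 6 * y + 3" "2 * x + 6 * y < 3 * E + 3" using E e1 by auto
    from j show ?thesis
    proof (elim disjE)
      assume j0: "j = 0"
      have "E = 2 * i + 2 * y" using bounds x j0 by linarith
      then show ?thesis using True xj j0 p e1 x by simp
    next
      assume j1: "j = 1"
      have "E = 2 * i + 2 * y \<or> E = 2 * i + 2 * y + 1" using bounds x j1 by linarith
      then show ?thesis using True xj j1 p e1 x by (elim disjE) simp_all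
    next
      assume j2: "j = 2"
      have "E = 2 * i + 2 * y + 1 \<or> E = 2 * i + 2 * y + 2" using bounds x j2 by linarith
      then show ?thesis using True xj j2 p e1 x by (elim disjE) simp_all
    qed
  next
    case False
    have e2: "e = 2" using e False by simp
    have bounds: "3 * E < 4 * x + 12 * y + 3" "4 * x + 12 * y < 3 * E + 3" using E e2 by auto
    from j show ?thesis
    proof (elim disjE)
      assume j0: "j = 0"
      have "E = 4 * i + 4 * y" using bounds x j0 by linarith
      then show ?thesis using False xj j0 p e2 x by simp
    next
      assume j1: "j = 1"
      have "E = 4 * i + 4 * y + 1 \<or> E = 4 * i + 4 * y + 2" using bounds x j1 by linarith
      then show ?thesis using False xj j1 p e2 x by (elim disjE) simp_all
    next
      assume j2: "j = 2"
      have "E = 4 * i + 4 * y + 2 \<or> E = 4 * i + 4 * y + 3" using bounds x j2 by linarith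
      then show ?thesis using False xj j2 p e2 x by (elim disjE) simp_all
    qed
  qed
qed

text \<open>As complex numbers, \<open>2(v \<bullet> w) = v w\<^sup>* + w v\<^sup>*\<close> and \<open>w \<bullet> w = w w\<^sup>*\<close>, with \<open>w\<^sup>*\<close> the conjugate.\<close>
lemma elastic_reflection_eq:
  assumes "w \<noteq> 0" shows "elastic_reflection w v = w / cnj w * cnj v"
proof -
  have 1: "of_real (2 * (v \<bullet> w)) = v * cnj w + w * cnj v"
    by (simp add: complex_eq_iff inner_complex_def algebra_simps)
  have 2: "of_real (w \<bullet> w) = w * cnj w"
    by (simp add: complex_eq_iff inner_complex_def algebra_simps)
  have "elastic_reflection w v = (v * cnj w + w * cnj v) / (w * cnj w) * w - v"
    unfolding elastic_reflection_def scaleR_conv_of_real of_real_divide 1 2 ..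
  also have "\<dots> = w / cnj w * cnj v" using assms by (simp add: field_simps)
  finally show ?thesis .
qed

text \<open>An affine function that is non-negative on a set and not constant is positive on its interior; \<open>d\<close> is
a direction along which it decreases.\<close>
lemma interior_positive:
  fixes f :: "complex \<Rightarrow> real"
  assumes "\<And>w. w \<in> S \<Longrightarrow> 0 \<le> f w" and "z \<in> interior S" and "\<And>e. f (z + e *\<^sub>R d) = f z - e * c" and "0 < c"
  shows "0 < f z"
proof -
  obtain r where r: "0 < r" "ball z r \<subseteq> S" using assms(2) by (auto simp: mem_interior)
  define e where "e = r / (2 * (norm d + 1))"
  have pos: "0 < norm d + 1" using norm_ge_zero[of d] by linarith
  have e: "0 < e" using r pos by (simp add: e_def)
  have "e * norm d < e * (2 * (norm d + 1))" using e by (intro mult_strict_left_mono) (use pos in simp_all)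
  also have "\<dots> = r" using pos by (simp add: e_def)
  finally have "e * norm d < r" .
  then have "z + e *\<^sub>R d \<in> ball z r" using e by (simp add: dist_norm)
  then have "z + e *\<^sub>R d \<in> S" using r by blast
  from assms(1)[OF this] have "0 \<le> f z - e * c" by (simp only: assms(3))
  then show ?thesis using e assms(4) by (smt (verit) mult_pos_pos)
qed

lemma isosceles_120_normal_form:
  assumes "isosceles_120 A B C"
  obtains L where "0 < L" "C = A + L *\<^sub>R 1" "B = A + L *\<^sub>R ((1 / 3) *\<^sub>R (1 + \<omega>))"
proof -
  define r H where "r = (Re C - Re A) / 2" and "H = Im B - Im A"
  have a: "dist A B = dist B C" "vec_angle (A - B) (C - B) = 2 * pi / 3" "Im A = Im C" "0 < r" "0 < H"
    using assms by (auto simp: isosceles_120_def r_def H_def)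
  have "(Re A - Re B)\<^sup>2 + (Im A - Im B)\<^sup>2 = (Re B - Re C)\<^sup>2 + (Im B - Im C)\<^sup>2"
    using a(1) by (simp add: dist_norm cmod_def)
  then have "(Re A - Re B)\<^sup>2 = (Re B - Re C)\<^sup>2" using a(3) by (simp add: power2_commute)
  then have "Re A - Re B = Re B - Re C"
    using a(4) by (simp add: r_def power2_eq_iff)
  then have mid: "Re B = Re A + r" "Re C = Re A + 2 * r" by (simp_all add: r_def field_simps)
  have AB: "A - B = Complex (- r) (- H)" and CB: "C - B = Complex r (- H)"
    using mid a(3) by (simp_all add: complex_eq_iff H_def)
  have pos: "0 < r\<^sup>2 + H\<^sup>2" using a(4) by (simp add: add_pos_nonneg)
  have "vec_angle (A - B) (C - B) = arccos ((H\<^sup>2 - r\<^sup>2) / (r\<^sup>2 + H\<^sup>2))"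
    unfolding vec_angle_def AB CB by (simp add: inner_complex_def cmod_def power2_eq_square)
  moreover have "-1 \<le> (H\<^sup>2 - r\<^sup>2) / (r\<^sup>2 + H\<^sup>2)" "(H\<^sup>2 - r\<^sup>2) / (r\<^sup>2 + H\<^sup>2) \<le> 1"
    using pos by (simp_all add: field_simps)
  ultimately have "(H\<^sup>2 - r\<^sup>2) / (r\<^sup>2 + H\<^sup>2) = cos (2 * pi / 3)"
    using a(2) by (metis cos_arccos)
  then have "(H\<^sup>2 - r\<^sup>2) / (r\<^sup>2 + H\<^sup>2) = - 1 / 2" by (simp add: cos_120)
  then have "H\<^sup>2 - r\<^sup>2 = - 1 / 2 * (r\<^sup>2 + H\<^sup>2)" using pos by (metis less_irrefl nonzero_divide_eq_eq)
  then have "r\<^sup>2 = 3 * H\<^sup>2" by argo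
  then have "r\<^sup>2 = (sqrt 3 * H)\<^sup>2" by (simp add: power_mult_distrib)
  then have r: "r = sqrt 3 * H" using a(4,5) by (simp add: power2_eq_iff_nonneg)
  show ?thesis
  proof (rule that[of "2 * r"])
    show "C = A + (2 * r) *\<^sub>R 1" using mid a(3) by (simp add: complex_eq_iff)
    have "Im B = Im A + H" by (simp add: H_def)
    then show "B = A + (2 * r) *\<^sub>R ((1 / 3) *\<^sub>R (1 + \<omega>))"
      using mid by (simp add: complex_eq_iff omega_def r)
  qed (use a in simp)
qed

lemma base_launch_direction:
  assumes u: "norm u = 1" and up: "0 < Im u" and r: "0 < r" and k: "0 < k"
    and angle: "vec_angle (of_real r) u = arctan k"
  shows "0 < Re u" "Im u = k * Re u"
proof -
  have "vec_angle (of_real r) u = arccos (Re u)"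
    using u r by (simp add: vec_angle_def inner_complex_def)
  moreover have "\<bar>Re u\<bar> \<le> 1" using abs_Re_le_cmod[of u] u by simp
  ultimately have "Re u = cos (arctan k)" using angle by (metis cos_arccos_abs)
  then have Re: "Re u = 1 / sqrt (1 + k\<^sup>2)" by (simp add: cos_arctan)
  have k2: "0 < 1 + k\<^sup>2" by (simp add: add_pos_nonneg)
  then show pos: "0 < Re u" by (simp add: Re)
  have "(Re u)\<^sup>2 * (1 + k\<^sup>2) = 1" using k2 by (simp add: Re power_divide)
  moreover have "(Re u)\<^sup>2 + (Im u)\<^sup>2 = 1" using u by (metis cmod_power2 one_power2)
  ultimately have "(Im u)\<^sup>2 = (k * Re u)\<^sup>2" by (simp add: power_mult_distrib algebra_simps)
  then show "Im u = k * Re u" using up pos k by (simp add: power2_eq_iff_nonneg)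
qed

text \<open>The similarity \<open>normalize\<close> maps the triangle to the one with corners \<open>0\<close>, \<open>(1 + \<omega>)/3\<close> and \<open>1\<close>.\<close>
locale scaled_triangle =
  fixes A B C :: complex and L :: real
  assumes L_pos: "0 < L" and C_eq: "C = A + L *\<^sub>R 1" and B_eq: "B = A + L *\<^sub>R ((1 / 3) *\<^sub>R (1 + \<omega>))"
begin

definition normalize :: "complex \<Rightarrow> complex" where "normalize z = (1 / L) *\<^sub>R (z - A)"

lemma normalize_add: "normalize (z + r *\<^sub>R d) = normalize z + (r / L) *\<^sub>R d"
  by (simp add: normalize_def algebra_simps)

lemma normalize_corners: "normalize A = 0" "normalize C = 1" "normalize B = (1 / 3) *\<^sub>R (1 + \<omega>)"
  using L_pos by (simp_all add: normalize_def C_eq B_eq)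

lemma normalize_diff: "normalize (z - r *\<^sub>R d) = normalize z - (r / L) *\<^sub>R d"
  by (simp add: normalize_def algebra_simps)

lemma normalize_combination: "normalize ((1 - u) *\<^sub>R z + u *\<^sub>R w) = (1 - u) *\<^sub>R normalize z + u *\<^sub>R normalize w"
proof -
  have "(1 - u) *\<^sub>R z + u *\<^sub>R w - A = (1 - u) *\<^sub>R (z - A) + u *\<^sub>R (w - A)"
    by (simp add: algebra_simps)
  then show ?thesis by (simp add: normalize_def scaleR_right_distrib)
qed

lemma normalize_inject: "normalize z = normalize w \<longleftrightarrow> z = w"
  using L_pos by (simp add: normalize_def)

lemma hull_normalized:
  assumes "z \<in> convex hull {A, B, C}"
  shows "0 \<le> ecb (normalize z)" "0 \<le> eca (normalize z) - ecb (normalize z)" "0 \<le> 1 - eca (normalize z) - 2 * ecb (normalize z)"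
proof -
  obtain u v w where uvw: "0 \<le> u" "0 \<le> v" "0 \<le> w" "u + v + w = 1" "z = u *\<^sub>R A + v *\<^sub>R B + w *\<^sub>R C"
    using assms unfolding convex_hull_3 by blast
  have "z = (u + v + w) *\<^sub>R A + (v * L) *\<^sub>R ((1 / 3) *\<^sub>R (1 + \<omega>)) + (w * L) *\<^sub>R 1"
    unfolding uvw(5) B_eq C_eq by (simp add: algebra_simps)
  then have "z = A + (v * L) *\<^sub>R ((1 / 3) *\<^sub>R (1 + \<omega>)) + (w * L) *\<^sub>R 1" using uvw(4) by simp
  then have "normalize z = v *\<^sub>R ((1 / 3) *\<^sub>R (1 + \<omega>)) + w *\<^sub>R 1"
    using L_pos by (simp add: normalize_add normalize_corners(1) del: scaleR_scaleR)
  then have "eca (normalize z) = v / 3 + w" "ecb (normalize z) = v / 3" by (simp_all add: omega_coords)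
  then show "0 \<le> ecb (normalize z)" "0 \<le> eca (normalize z) - ecb (normalize z)" "0 \<le> 1 - eca (normalize z) - 2 * ecb (normalize z)"
    using uvw(1-4) by simp_all
qed

lemma interior_normalized:
  assumes z: "z \<in> interior (convex hull {A, B, C})" shows "normalize z \<in> chamber"
proof -
  have 1: "0 < ecb (normalize z)"
    by (rule interior_positive[OF hull_normalized(1) z, where d = "- \<omega>" and c = "1 / L"])
      (use L_pos in \<open>simp_all add: normalize_add normalize_diff omega_coords\<close>)
  have 2: "0 < eca (normalize z) - ecb (normalize z)"
    by (rule interior_positive[OF hull_normalized(2) z, where d = \<omega> and c = "1 / L"])
      (use L_pos in \<open>simp_all add: normalize_add normalize_diff omega_coords\<close>)
  have 3: "0 < 1 - eca (normalize z) - 2 * ecb (normalize z)"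
    by (rule interior_positive[OF hull_normalized(3) z, where d = \<omega> and c = "2 / L"])
      (use L_pos in \<open>simp_all add: normalize_add normalize_diff omega_coords\<close>)
  show ?thesis using 1 2 3 by (simp add: chamber_def)
qed

lemma edges_normalized:
  "z \<in> open_segment A C \<Longrightarrow> normalize z \<in> base_edge" "z \<in> open_segment A B \<Longrightarrow> normalize z \<in> left_edge"
  "z \<in> open_segment B C \<Longrightarrow> normalize z \<in> right_edge"
proof -
  have param: "\<exists>u. 0 < u \<and> u < 1 \<and> normalize z = (1 - u) *\<^sub>R normalize v + u *\<^sub>R normalize w" if "z \<in> open_segment v w" for v w
    using that normalize_combination by (auto simp: in_segment)
  show "normalize z \<in> base_edge" if "z \<in> open_segment A C"
    using param[OF that] by (auto simp: normalize_corners base_edge_def)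
  show "normalize z \<in> left_edge" if "z \<in> open_segment A B"
    using param[OF that] by (auto simp: normalize_corners left_edge_def omega_coords)
  show "normalize z \<in> right_edge" if "z \<in> open_segment B C"
    using param[OF that] by (auto simp: normalize_corners right_edge_def omega_coords field_simps)
qed

lemma edge_frontier:
  assumes "z \<in> open_segment A C \<or> z \<in> open_segment A B \<or> z \<in> open_segment B C"
  shows "z \<in> frontier (convex hull {A, B, C})"
proof -
  have "z \<in> convex hull {A, C} \<union> convex hull {A, B} \<union> convex hull {B, C}"
    using assms by (auto simp: open_segment_def segment_convex_hull)
  also have "\<dots> \<subseteq> convex hull {A, B, C}" by (intro Un_least hull_mono) auto
  finally have "z \<in> closure (convex hull {A, B, C})" using closure_subset by blast
  moreover have "normalize z \<notin> chamber"
    using assms edges_normalized[of z]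
    by (auto simp: chamber_def base_edge_def left_edge_def right_edge_def)
  ultimately show ?thesis using interior_normalized unfolding frontier_def by blast
qed

lemma reflections:
  "elastic_reflection (A - C) v = cnj v" "elastic_reflection (B - A) v = \<omega> * cnj v"
  "elastic_reflection (C - B) v = cnj \<omega> * cnj v"
proof -
  have refl: "elastic_reflection w v = g * cnj v" if "w = g * cnj w" "w \<noteq> 0" for w g
  proof -
    have "w / cnj w = g" using that by (metis complex_cnj_zero_iff nonzero_divide_eq_eq)
    then show ?thesis using elastic_reflection_eq[OF that(2)] by simp
  qed
  have ne: "A - C \<noteq> 0" "B - A \<noteq> 0" "C - B \<noteq> 0"
  proof -
    have "normalize A \<noteq> normalize C" unfolding normalize_corners by simp
    moreover have "ecb (normalize A) \<noteq> ecb (normalize B)" "ecb (normalize C) \<noteq> ecb (normalize B)"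
      unfolding normalize_corners by (simp_all add: omega_coords)
    ultimately show "A - C \<noteq> 0" "B - A \<noteq> 0" "C - B \<noteq> 0" by auto
  qed
  have "A - C = 1 * cnj (A - C)" by (simp add: C_eq)
  then show "elastic_reflection (A - C) v = cnj v" using refl[OF _ ne(1), of 1] by simp
  have "B - A = \<omega> * cnj (B - A)"
    unfolding B_eq by (intro coords_eqI) (simp_all add: omega_coords)
  then show "elastic_reflection (B - A) v = \<omega> * cnj v" using refl ne by blast
  have "C - B = cnj \<omega> * cnj (C - B)"
    unfolding B_eq C_eq cnj_omega
    by (intro coords_eqI) (simp_all add: omega_coords numeral_eq_Suc mult.assoc)
  then show "elastic_reflection (C - B) v = cnj \<omega> * cnj v" using refl ne by blast
qed

end

text \<open>The vector \<open>x + y\<surd>3 \<i>\<close> equals \<open>(x - y) + 2y\<omega>\<close>. It is primitive if \<open>x\<close> and \<open>y\<close> have different parity,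
and otherwise twice a primitive vector.\<close>
lemma lattice_direction:
  fixes x y :: nat
  assumes "0 < x" "x < y" "gcd x y = 1" and e: "e = (if x mod 2 = y mod 2 then 1 else 2)"
  obtains a b :: int where "coprime a b" "a < 0" "2 * a + b = int (e * x)" "b = int (e * y)"
proof (cases "x mod 2 = y mod 2")
  case True
  then have e1: "e = 1" using e by simp
  define a where "a = (int x - int y) div 2"
  have "even (int x - int y)" using True by presburger
  then have a: "2 * a + int y = int x" unfolding a_def by presburger
  have "gcd a (int y) dvd 2 * a + int y" "gcd a (int y) dvd int y" by simp_all
  then have "gcd a (int y) dvd gcd (int x) (int y)" unfolding a by (rule gcd_greatest)
  then have "gcd a (int y) dvd 1" unfolding gcd_int_int_eq assms(3) by simp
  then have "coprime a (int y)" by (simp add: coprime_iff_gcd_eq_1)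
  moreover have "a < 0" using a assms(2) by linarith
  ultimately show ?thesis by (rule that) (use a e1 in simp_all)
next
  case False
  then have e2: "e = 2" using e by simp
  have "coprime x y" using assms(3) by (simp add: coprime_iff_gcd_eq_1)
  then have "coprime (int x) (int y)" by simp
  then have "coprime (int x - int y) (int y)"
    by (metis coprime_iff_gcd_eq_1 gcd_diff1)
  moreover have "odd (int x - int y)" using False by presburger
  ultimately have "coprime (int x - int y) (2 * int y)" by simp
  then show ?thesis by (rule that) (use assms(2) e2 in simp_all)
qed

theorem theorem2p12:
  fixes A B C P u :: complex and q :: "real \<Rightarrow> complex" and x y :: nat
  assumes "0 < x" and "x < y" and "gcd x y = 1"
    and "isosceles_120 A B C"
    and "P \<in> open_segment A C"
    and "nonsingular_orbit A B C u q" and "q 0 = P"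
    and "vec_angle (C - P) u = arctan (real y / real x * sqrt 3)"
    and "periodic_orbit q"
  defines "p \<equiv> real (orbit_period A B C q)"
  shows "(x mod 3 = 0 \<and> x mod 2 = y mod 2 \<longrightarrow>
            p = 4 * real y + 2 * real x / 3) \<and>
         (x mod 3 = 0 \<and> x mod 2 \<noteq> y mod 2 \<longrightarrow>
            p = 8 * real y + 4 * real x / 3) \<and>
         (x mod 3 = 1 \<and> x mod 2 = y mod 2 \<longrightarrow>
            p = 4 * real y + (2 * real x - 2) / 3 \<or> p = 8 * real y + (4 * real x + 2) / 3) \<and>
         (x mod 3 = 1 \<and> x mod 2 \<noteq> y mod 2 \<longrightarrow>
            p = 16 * real y + (8 * real x - 2) / 3 \<or> p = 8 * real y + (4 * real x + 2) / 3) \<and>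
         (x mod 3 = 2 \<and> x mod 2 = y mod 2 \<longrightarrow>
            p = 4 * real y + (2 * real x + 2) / 3 \<or> p = 8 * real y + (4 * real x - 2) / 3) \<and>
         (x mod 3 = 2 \<and> x mod 2 \<noteq> y mod 2 \<longrightarrow>
            p = 16 * real y + (8 * real x + 2) / 3 \<or> p = 8 * real y + (4 * real x - 2) / 3)"
proof -
  obtain L where "0 < L" "C = A + L *\<^sub>R 1" "B = A + L *\<^sub>R ((1 / 3) *\<^sub>R (1 + \<omega>))"
    using isosceles_120_normal_form[OF assms(4)] .
  then interpret scaled_triangle A B C L by unfold_locales
  obtain t v where t0: "t 0 = 0" and v0: "v 0 = u" and u1: "norm u = 1"
    and tless: "\<And>n. t n < t (Suc n)" and tlim: "filterlim t at_top sequentially"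
    and fly: "\<And>n s. s \<in> {t n..t (Suc n)} \<Longrightarrow> q s = q (t n) + (s - t n) *\<^sub>R v n"
    and ins: "\<And>n s. s \<in> {t n<..<t (Suc n)} \<Longrightarrow> q s \<in> interior (convex hull {A, B, C})"
    and bnc: "\<And>n. \<exists>(a, b)\<in>{(A, B), (B, C), (C, A)}. q (t (Suc n)) \<in> open_segment a b \<and>
           v (Suc n) = elastic_reflection (b - a) (v n)"
    using assms(6) unfolding nonsingular_orbit_def by blast
  have side_hit: "q (t (Suc n)) \<in> open_segment A C \<and> v (Suc n) = cnj (v n) \<or>
      q (t (Suc n)) \<in> open_segment A B \<and> v (Suc n) = \<omega> * cnj (v n) \<or>
      q (t (Suc n)) \<in> open_segment B C \<and> v (Suc n) = cnj \<omega> * cnj (v n)" for n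
    using bnc[of n] by (auto simp: reflections open_segment_commute)
  have Im_u: "0 < Im u"
  proof -
    define r where "r = t 1 / 2"
    have r: "0 < r" "r < t 1" using tless[of 0] t0 by (simp_all add: r_def)
    then have "normalize (q r) \<in> chamber" using ins[of r 0] t0 interior_normalized by simp
    moreover have "q r = P + r *\<^sub>R u" using fly[of r 0] r t0 v0 assms(7) by simp
    moreover have "ecb (normalize P) = 0" using edges_normalized(1)[OF assms(5)] by (simp add: base_edge_def)
    ultimately have "0 < r / L * ecb u" by (simp add: chamber_def normalize_add)
    then have "0 < ecb u" using r L_pos by (simp add: zero_less_mult_iff zero_less_divide_iff)
    then show ?thesis by (simp add: ecb_def zero_less_divide_iff)
  qed
  obtain k where "0 < k" "C - P = of_real k"
  proof -
    obtain k where k: "0 < k" "k < 1" "P = (1 - k) *\<^sub>R A + k *\<^sub>R C" using assms(5) by (auto simp: in_segment)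
    have "C - P = of_real ((1 - k) * L)" unfolding k(3) C_eq
      by (simp add: complex_eq_iff algebra_simps)
    then show ?thesis using that[of "(1 - k) * L"] k L_pos by simp
  qed
  then have dir: "0 < Re u" "Im u = real y / real x * sqrt 3 * Re u"
    using base_launch_direction[OF u1 Im_u, of k "real y / real x * sqrt 3"] assms(1,2,8) by simp_all
  define e :: nat where "e = (if x mod 2 = y mod 2 then 1 else 2)"
  obtain a b where cop: "coprime a b" and a: "a < 0" and ab: "2 * a + b = int (e * x)" "b = int (e * y)"
    using lattice_direction[OF assms(1-3) e_def] .
  \<comment> \<open>The factor that stretches the unit vector \<open>u\<close> to the primitive lattice vector \<open>a + b\<omega>\<close>.\<close>
  define c where "c = real (e * x) / (2 * Re u)"
  have c: "0 < c" using assms(1) dir(1) by (simp add: c_def e_def)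
  have Re_c: "c * Re u = real_of_int (2 * a + b) / 2" unfolding ab(1) using dir(1) by (simp add: c_def)
  have "c * Im u = real y / real x * sqrt 3 * (c * Re u)" using dir(2) by simp
  then have Im_c: "c * Im u = real_of_int b * sqrt 3 / 2" unfolding Re_c ab(1) unfolding ab(2) using assms(1) by simp
  have "Re (c *\<^sub>R u) = real_of_int (2 * a + b) / 2" "Im (c *\<^sub>R u) = real_of_int b * sqrt 3 / 2"
    using Re_c Im_c by simp_all
  note components = this
  have direction: "eca (c *\<^sub>R u) = a" "ecb (c *\<^sub>R u) = b"
    unfolding eca_def ecb_def components by (simp_all add: add_divide_distrib)
  define T where "T = c * L"
  have T: "0 < T" "T / L = c" using c L_pos by (simp_all add: T_def)
  interpret base_billiard "\<lambda>s. normalize (q (T * s))" "\<lambda>n. t n / T" "\<lambda>n. c *\<^sub>R v n" a b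
  proof
    show "filterlim (\<lambda>n. t n / T) at_top sequentially"
      unfolding filterlim_at_top_dense
    proof
      fix Z
      have "eventually (\<lambda>n. Z * T < t n) sequentially" using tlim unfolding filterlim_at_top_dense by blast
      then show "eventually (\<lambda>n. Z < t n / T) sequentially" by (simp add: pos_less_divide_eq[OF T(1)])
    qed
  next
    fix s n
    assume "s \<in> {t n / T..t (Suc n) / T}"
    then have "T * s \<in> {t n..t (Suc n)}" using T(1) by (simp add: field_simps)
    from fly[OF this] have "normalize (q (T * s)) = normalize (q (t n)) + ((T * s - t n) / L) *\<^sub>R v n"
      by (simp add: normalize_add)
    moreover have "(T * s - t n) / L = (s - t n / T) * c"
      using T L_pos by (simp add: T(2)[symmetric] field_simps)
    ultimately show "normalize (q (T * s)) = normalize (q (T * (t n / T))) + (s - t n / T) *\<^sub>R c *\<^sub>R v n"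
      using T(1) by simp
  next
    fix s n
    assume "s \<in> {t n / T<..<t (Suc n) / T}"
    then have "T * s \<in> {t n<..<t (Suc n)}" using T(1) by (simp add: field_simps)
    then show "normalize (q (T * s)) \<in> chamber" using ins interior_normalized by blast
  next
    fix n
    show "normalize (q (T * (t (Suc n) / T))) \<in> base_edge \<and> c *\<^sub>R v (Suc n) = cnj (c *\<^sub>R v n) \<or>
      normalize (q (T * (t (Suc n) / T))) \<in> left_edge \<and> c *\<^sub>R v (Suc n) = \<omega> * cnj (c *\<^sub>R v n) \<or>
      normalize (q (T * (t (Suc n) / T))) \<in> right_edge \<and> c *\<^sub>R v (Suc n) = cnj \<omega> * cnj (c *\<^sub>R v n)"
      using side_hit[of n] edges_normalized[of "q (t (Suc n))"] T(1) by auto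
  next
    show "normalize (q (T * 0)) \<in> base_edge" using edges_normalized(1)[OF assms(5)] assms(7) by simp
  qed (use t0 tless T(1) v0 direction cop a ab assms(1) in
      \<open>simp_all add: divide_strict_right_mono e_def\<close>)
  have retraces: "retraces_after q r \<longleftrightarrow> retraces_after (\<lambda>s. normalize (q (T * s))) (r / T)" for r
  proof -
    have "(\<forall>s\<ge>0. q (s + r) = q s) \<longleftrightarrow> (\<forall>s\<ge>0. q (T * (s + r / T)) = q (T * s))"
    proof (intro iffI allI impI)
      fix s :: real assume "\<forall>s\<ge>0. q (s + r) = q s" "0 \<le> s"
      then have "q (T * s + r) = q (T * s)" using T(1) by simp
      then show "q (T * (s + r / T)) = q (T * s)" using T(1) by (simp add: distrib_left)
    next
      fix s :: real assume "\<forall>s\<ge>0. q (T * (s + r / T)) = q (T * s)" "0 \<le> s"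
      then have "q (T * (s / T + r / T)) = q (T * (s / T))" using T(1) by simp
      then show "q (s + r) = q s" using T(1) by (simp add: distrib_left)
    qed
    then show ?thesis using T(1) by (simp add: retraces_after_def normalize_inject zero_less_divide_iff)
  qed
  have duration: "primitive_duration q = T * period"
    unfolding primitive_duration_def
  proof (rule Least_equality)
    show "retraces_after q (T * period)" using retraces_after_period T(1) by (simp add: retraces)
    show "T * period \<le> r" if "retraces_after q r" for r
      using period_le[of "r / T"] that T(1) by (simp add: retraces field_simps)
  qed
  have frontier: "q (T * s) \<in> frontier (convex hull {A, B, C}) \<longleftrightarrow> (\<exists>n. s = t (Suc n) / T)" if "0 < s" for s
    using that
  proof (cases rule: time_cases)
    case (strike n)
    then have "T * s = t (Suc n)" using T(1) by simp
    then have "q (T * s) \<in> frontier (convex hull {A, B, C})"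
      using edge_frontier[of "q (T * s)"] side_hit[of n] by auto
    then show ?thesis using strike by blast
  next
    case (flying n)
    then have "T * s \<in> {t n<..<t (Suc n)}" using T(1) by (simp add: field_simps)
    then have "q (T * s) \<notin> frontier (convex hull {A, B, C})" using ins by (auto simp: frontier_def)
    moreover have "\<not> (\<exists>m. s = t (Suc m) / T)"
      using flying strike_iff_edge[OF that] flying_no_edge[OF flying] by blast
    ultimately show ?thesis by blast
  qed
  have "{s \<in> {0<..primitive_duration q}. q s \<in> frontier (convex hull {A, B, C})} = (\<lambda>s. T * s) ` strikes period"
  proof (intro set_eqI iffI)
    fix s assume s: "s \<in> {s \<in> {0<..primitive_duration q}. q s \<in> frontier (convex hull {A, B, C})}"
    then have "s / T \<in> strikes period"
      using T(1) frontier[of "s / T"] by (auto simp: strikes_def duration field_simps)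
    then show "s \<in> (\<lambda>s. T * s) ` strikes period" using T(1) by (intro image_eqI[of _ _ "s / T"]) auto
  next
    fix s assume "s \<in> (\<lambda>s. T * s) ` strikes period"
    then obtain r where r: "s = T * r" "0 < r" "r \<le> period" "\<exists>n. r = t (Suc n) / T"
      by (auto simp only: strikes_def image_iff mem_Collect_eq greaterThanAtMost_iff)
    then have "q s \<in> frontier (convex hull {A, B, C})" using frontier by blast
    then show "s \<in> {s \<in> {0<..primitive_duration q}. q s \<in> frontier (convex hull {A, B, C})}"
      using r T(1) by (simp add: duration)
  qed
  then have "orbit_period A B C q = card (strikes period)"
    unfolding orbit_period_def using T(1) by (simp add: card_image inj_on_def)
  also have "\<dots> = (if even side_hits then 2 * (e * y) + side_hits else 2 * (2 * (e * y) + side_hits))"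
    unfolding card_strikes_period ab(2) by (simp add: nat_mult_distrib)
  finally show ?thesis
    unfolding p_def using count_edges(4) ab
    by (intro period_arith[OF e_def]) simp_all
qed

end
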